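(* Let $p\ge 3$ be a prime, let $N$ be a positive integer coprime to $p$, and let $\alpha\ge 0$ be an integer. (1) If $p\equiv 1 \pmod 3$, then $\overline{p}(3p^{6\alpha+5}N)\equiv 0 \pmod 3$ and $\overline{p}(3p^{18\alpha+17}N)\equiv 0 \pmod 9$. (2) If $p\equiv 2 \pmod 3$, then $\overline{p}(3p^{4\alpha+3}N)\equiv 0 \pmod 9$.
   Context: An overpartition of a nonnegative integer $n$ is a partition of $n$ in which the first occurrence of each distinct part may (or may not) be overlined; $\overline{p}(n)$ denotes the number of overpartitions of $n$ (with $\overline{p}(0)=1$). Equivalently, $\sum_{n\ge0}\overline{p}(n)q^n=\prod_{k\ge1}\frac{1+q^k}{1-q^k}$. *)

theory Defs
  imports Main "HOL-Library.Multiset" "HOL-Computational_Algebra.Primes"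
begin

text \<open>An overpartition of n: a partition of n (a multiset of positive parts summing to n)
together with the set of distinct parts whose first occurrence is overlined.\<close>

definition overpartitions :: "nat \<Rightarrow> (nat multiset \<times> nat set) set" where
  "overpartitions n = {(M, S). (\<forall>k\<in>#M. 0 < k) \<and> sum_mset M = n \<and> S \<subseteq> set_mset M}"

definition overpartition_count :: "nat \<Rightarrow> nat" where
  "overpartition_count n = card (overpartitions n)"

end

theory Submission
  imports Defs
    "HOL-Computational_Algebra.Formal_Laurent_Series"
    "HOL-Number_Theory.Cong"
    "Jordan_Normal_Form.Determinant"
begin

text \<open>
  Let \<open>\<theta> = \<Sum>\<^sub>x q\<^bsup>x\<^sup>2\<^esup>\<close>, summed over the integers. By Gauss, \<open>\<theta>\<close> is the inverse of the series with
  coefficients \<open>(-1)\<^sup>n\<close> times the overpartition numbers. Splitting \<open>\<theta>\<close> by residues modulo 3 and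
  using the \<open>3\<close>-scaled isometry between \<open>\<int>\<^sup>4\<close> and the lattice of the tetracode, the coefficients at
  multiples of 3 form the series \<open>\<theta>(q\<^sup>3)\<^sup>3 / \<theta>(q)\<^sup>4\<close>, which is congruent to \<open>\<theta>\<^sup>5\<close> modulo 9. So, up to
  sign and modulo 9, the number of overpartitions of \<open>3n\<close> is the number \<open>r(n)\<close> of representations of
  \<open>n\<close> as a sum of five squares.

  By Hermite's bound every unimodular lattice of rank at most 5 is isometric to some \<open>\<int>\<^sup>n\<close>; in
  particular this holds for the \<open>p\<close>-neighbours of \<open>\<int>\<^sup>5\<close>, which are indexed by the isotropic lines
  modulo \<open>p\<close>. Counting the vectors of norm \<open>k\<close> (with \<open>p\<close> dividing \<open>k\<close>) in all neighbours in two ways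
  shows that passing from \<open>k\<close> to \<open>p\<^sup>2k\<close> multiplies by \<open>p\<^sup>3\<close> the number of representations that do not
  vanish modulo \<open>p\<close>. Hence \<open>r(p\<^bsup>2j+1\<^esup>N) = r(pN) (1 + p\<^sup>3 + \<dots> + p\<^bsup>3j\<^esup>)\<close> for \<open>N\<close> coprime to \<open>p\<close>, and
  \<open>p\<^sup>3\<close> is \<open>\<plusminus>1\<close> modulo 9.
\<close>

unbundle no Formal_Power_Series.fps_syntax

section \<open>Gauss' identity for overpartitions\<close>

definition bounded_overpartitions :: "nat \<Rightarrow> nat \<Rightarrow> (nat multiset \<times> nat set) set" where
  "bounded_overpartitions m n = {(M, S) \<in> overpartitions n. \<forall>k\<in>#M. k \<le> m}"

lemma bounded_overpartitions_iff:
  "(M, S) \<in> bounded_overpartitions m n \<longleftrightarrow>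
     (\<forall>k\<in>#M. 0 < k \<and> k \<le> m) \<and> sum_mset M = n \<and> S \<subseteq> set_mset M"
  by (auto simp: bounded_overpartitions_def overpartitions_def)

lemma bounded_overpartitions_0:
  "bounded_overpartitions 0 n = (if n = 0 then {({#}, {})} else {})"
proof -
  have "M = {#}" if "(M, S) \<in> bounded_overpartitions 0 n" for M S
    using that by (cases M) (auto simp: bounded_overpartitions_iff)
  then have "(M, S) \<in> bounded_overpartitions 0 n \<longleftrightarrow> M = {#} \<and> S = {} \<and> n = 0" for M S
    by (auto simp: bounded_overpartitions_iff)
  then show ?thesis by auto
qed

lemma bounded_overpartitions_eq_overpartitions:
  assumes "n \<le> m" shows "bounded_overpartitions m n = overpartitions n"
proof -
  have "k \<le> m" if "k \<in># M" "sum_mset M = n" for k M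
    using that assms by (auto dest!: multi_member_split)
  then show ?thesis by (auto simp: bounded_overpartitions_def overpartitions_def)
qed

fun add_part :: "nat \<Rightarrow> nat multiset \<times> nat set \<Rightarrow> nat multiset \<times> nat set" where
  "add_part s (M, S) = (add_mset s M, S)"

fun add_overlined_part :: "nat \<Rightarrow> nat multiset \<times> nat set \<Rightarrow> nat multiset \<times> nat set" where
  "add_overlined_part s (M, S) = (add_mset s M, insert s S)"

text \<open>Removing a copy of \<open>s\<close> leaves an overpartition unless that copy was the only one and was
  overlined.\<close>

lemma image_add_part:
  assumes "0 < s"
  shows "add_part s ` bounded_overpartitions s n =
    {(M, S) \<in> bounded_overpartitions s (n + s). s \<in># M \<and> S \<subseteq> set_mset (M - {#s#})}"
proof (intro equalityI subsetI)
  fix x assume x: "x \<in> {(M, S) \<in> bounded_overpartitions s (n + s).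
    s \<in># M \<and> S \<subseteq> set_mset (M - {#s#})}"
  then obtain M S where "x = (add_mset s M, S)" by (auto dest!: multi_member_split)
  with x show "x \<in> add_part s ` bounded_overpartitions s n"
    by (intro image_eqI[of _ _ "(M, S)"]) (auto simp: bounded_overpartitions_iff)
qed (use assms in \<open>auto simp: bounded_overpartitions_iff\<close>)

lemma image_add_overlined_part:
  "add_overlined_part (Suc m) ` bounded_overpartitions m n =
    {(M, S) \<in> bounded_overpartitions (Suc m) (n + Suc m).
      Suc m \<in># M \<and> \<not> S \<subseteq> set_mset (M - {#Suc m#})}"
  (is "_ = ?R")
proof (intro equalityI subsetI)
  fix x assume x: "x \<in> ?R"
  then obtain M S where MS: "x = (add_mset (Suc m) M, S)" by (auto dest!: multi_member_split)
  with x have new: "Suc m \<in> S" "Suc m \<notin># M" by (auto simp: bounded_overpartitions_iff)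
  then have "k \<le> m" if "k \<in># M" for k
    using x that by (auto simp: MS bounded_overpartitions_iff le_Suc_eq)
  with x new have "(M, S - {Suc m}) \<in> bounded_overpartitions m n"
    by (auto simp: MS bounded_overpartitions_iff)
  moreover have "x = add_overlined_part (Suc m) (M, S - {Suc m})" using new by (auto simp: MS)
  ultimately show "x \<in> add_overlined_part (Suc m) ` bounded_overpartitions m n"
    by (rule image_eqI[rotated])
next
  fix x assume "x \<in> add_overlined_part (Suc m) ` bounded_overpartitions m n"
  then obtain M S where MS: "(M, S) \<in> bounded_overpartitions m n"
    and x: "x = (add_mset (Suc m) M, insert (Suc m) S)"
    by auto
  then have "Suc m \<notin># M" by (fastforce simp: bounded_overpartitions_iff)
  with MS show "x \<in> ?R" by (auto simp: x bounded_overpartitions_iff le_SucI)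
qed

lemma bounded_overpartitions_Suc_less:
  assumes "n < Suc m" shows "bounded_overpartitions (Suc m) n = bounded_overpartitions m n"
  using assms bounded_overpartitions_eq_overpartitions[of n] by simp

lemma bounded_overpartitions_Suc_add:
  "bounded_overpartitions (Suc m) (n + Suc m) = bounded_overpartitions m (n + Suc m) \<union>
     (add_part (Suc m) ` bounded_overpartitions (Suc m) n \<union>
      add_overlined_part (Suc m) ` bounded_overpartitions m n)"
  unfolding image_add_part[OF zero_less_Suc] image_add_overlined_part
  by (auto simp: bounded_overpartitions_iff le_Suc_eq)

lemma finite_bounded_overpartitions: "finite (bounded_overpartitions m n)"
proof (induction m arbitrary: n)
  case 0
  then show ?case by (simp add: bounded_overpartitions_0)
next
  case (Suc m)
  show ?case
  proof (induction n rule: less_induct)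
    case (less n)
    show ?case
    proof (cases "n < Suc m")
      case True
      then show ?thesis using Suc.IH by (simp add: bounded_overpartitions_Suc_less)
    next
      case False
      then obtain l where "n = l + Suc m" by (metis add.commute le_Suc_ex not_less)
      then show ?thesis
        using Suc.IH less.IH[of l] by (simp add: bounded_overpartitions_Suc_add del: add_Suc_right)
    qed
  qed
qed

lemma card_bounded_overpartitions_Suc_add:
  "card (bounded_overpartitions (Suc m) (n + Suc m)) = card (bounded_overpartitions m (n + Suc m)) +
     (card (bounded_overpartitions (Suc m) n) + card (bounded_overpartitions m n))"
proof -
  let ?A = "add_part (Suc m) ` bounded_overpartitions (Suc m) n"
    and ?B = "add_overlined_part (Suc m) ` bounded_overpartitions m n"
  have "bounded_overpartitions m (n + Suc m) \<inter> (?A \<union> ?B) = {}" "?A \<inter> ?B = {}"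
    unfolding image_add_part[OF zero_less_Suc] image_add_overlined_part
    by (fastforce simp: bounded_overpartitions_iff)+
  moreover have "card ?A = card (bounded_overpartitions (Suc m) n)"
    by (rule card_image) (auto simp: inj_on_def)
  moreover have "card ?B = card (bounded_overpartitions m n)"
  proof (rule card_image, rule inj_onI, clarify)
    fix M S M' S' assume "(M, S) \<in> bounded_overpartitions m n"
      "(M', S') \<in> bounded_overpartitions m n"
      and eq: "add_overlined_part (Suc m) (M, S) = add_overlined_part (Suc m) (M', S')"
    then have "Suc m \<notin> S" "Suc m \<notin> S'" by (fastforce simp: bounded_overpartitions_iff)+
    with eq show "M = M' \<and> S = S'" by (simp add: insert_ident)
  qed
  ultimately show ?thesis
    by (simp add: bounded_overpartitions_Suc_add finite_bounded_overpartitions card_Un_disjoint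
          del: add_Suc_right)
qed

definition bounded_gf :: "nat \<Rightarrow> int fps" where
  "bounded_gf m = Abs_fps (\<lambda>n. int (card (bounded_overpartitions m n)))"

lemma bounded_gf_0: "bounded_gf 0 = 1"
  by (auto simp: fps_eq_iff bounded_gf_def bounded_overpartitions_0)

lemma bounded_gf_Suc:
  "bounded_gf (Suc m) - bounded_gf m = fps_X ^ Suc m * (bounded_gf (Suc m) + bounded_gf m)"
proof (rule fps_ext)
  fix n
  show "fps_nth (bounded_gf (Suc m) - bounded_gf m) n
      = fps_nth (fps_X ^ Suc m * (bounded_gf (Suc m) + bounded_gf m)) n"
  proof (cases "n < Suc m")
    case True
    then show ?thesis
      by (simp add: bounded_gf_def bounded_overpartitions_Suc_less fps_X_power_mult_nth
            del: power_Suc)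
  next
    case False
    then obtain l where "n = l + Suc m" by (metis add.commute le_Suc_ex not_less)
    then show ?thesis
      using card_bounded_overpartitions_Suc_add[of m l]
      by (simp add: bounded_gf_def fps_X_power_mult_nth del: power_Suc)
  qed
qed

lemma one_minus_X_power_times_bounded_gf:
  "(1 - fps_X ^ Suc m) * bounded_gf (Suc m) = (1 + fps_X ^ Suc m) * bounded_gf m"
  using bounded_gf_Suc[of m] by (simp add: algebra_simps del: power_Suc)

definition alternating_theta :: "nat \<Rightarrow> int fps" where
  "alternating_theta n = (\<Sum>x\<in>{- int n..int n}. (-1) ^ nat \<bar>x\<bar> * fps_X ^ nat (x\<^sup>2))"

lemma alternating_theta_0: "alternating_theta 0 = 1"
  by (simp add: alternating_theta_def)

lemma alternating_theta_Suc:
  "alternating_theta (Suc n) = alternating_theta n - 2 * (-1) ^ n * fps_X ^ ((Suc n)\<^sup>2)"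
proof -
  have "{- int (Suc n)..int (Suc n)}
      = insert (int (Suc n)) (insert (- int (Suc n)) {- int n..int n})"
    by auto
  moreover have "nat ((int (Suc n))\<^sup>2) = (Suc n)\<^sup>2"
    by (metis nat_int of_nat_power)
  ultimately show ?thesis
    by (simp add: alternating_theta_def del: of_nat_Suc)
qed

text \<open>As in Shanks' finite form of the pentagonal number theorem, \<open>shanks_sum n n\<close> is the error term
  of Gauss' identity truncated at \<open>n\<close>.\<close>

definition shanks_sum :: "nat \<Rightarrow> nat \<Rightarrow> int fps" where
  "shanks_sum n m = (\<Sum>s=1..m. (-1) ^ s * fps_X ^ (s * Suc n) * (bounded_gf s + bounded_gf (s - 1)))"

lemma shanks_sum_Suc:
  "shanks_sum n (Suc m) = shanks_sum n m
     - (-1) ^ m * fps_X ^ (Suc m * Suc n) * (bounded_gf (Suc m) + bounded_gf m)"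
  by (simp add: shanks_sum_def del: mult_Suc mult_Suc_right)

lemma shanks_sum_telescope:
  "(1 - fps_X ^ Suc n) * (1 + shanks_sum (Suc n) m) =
     (1 + fps_X ^ Suc n) * (1 + shanks_sum n m)
       - 2 * (-1) ^ m * fps_X ^ (Suc m * Suc n) * bounded_gf m"
proof (induction m)
  case 0
  then show ?case by (simp add: shanks_sum_def bounded_gf_0)
next
  case (Suc m)
  define q Q r where "q = (fps_X ^ Suc n :: int fps)" and "Q = (fps_X ^ (Suc m * Suc n) :: int fps)"
    and "r = (-1 :: int fps) ^ m"
  have X_power_Suc_Suc: "(fps_X ^ (Suc m * Suc (Suc n)) :: int fps) = Q * fps_X ^ Suc m"
    and X_power_step: "(fps_X ^ (Suc (Suc m) * Suc n) :: int fps) = q * Q"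
    by (simp_all add: q_def Q_def flip: power_add del: power_Suc)
  have "(1 - q) * (1 + shanks_sum (Suc n) (Suc m))
      = (1 - q) * (1 + shanks_sum (Suc n) m)
        - r * Q * (1 - q) * (fps_X ^ Suc m * (bounded_gf (Suc m) + bounded_gf m))"
    by (simp only: shanks_sum_Suc X_power_Suc_Suc r_def) (simp add: algebra_simps del: power_Suc)
  also have "\<dots> = (1 + q) * (1 + shanks_sum n m) - 2 * r * Q * bounded_gf m
        - r * Q * (1 - q) * (bounded_gf (Suc m) - bounded_gf m)"
    using Suc.IH by (simp only: q_def Q_def r_def bounded_gf_Suc)
  also have "\<dots> = (1 + q) * (1 + shanks_sum n m - r * Q * (bounded_gf (Suc m) + bounded_gf m))
        + 2 * r * (q * Q) * bounded_gf (Suc m)"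
    by (simp add: algebra_simps)
  also have "\<dots> = (1 + q) * (1 + shanks_sum n (Suc m)) + 2 * r * (q * Q) * bounded_gf (Suc m)"
    by (simp only: shanks_sum_Suc Q_def r_def add_diff_eq)
  finally show ?case by (simp add: X_power_step q_def r_def del: mult_Suc mult_Suc_right)
qed

lemma alternating_theta_times_bounded_gf:
  "alternating_theta n * bounded_gf n = 1 + shanks_sum n n"
proof (induction n)
  case 0
  then show ?case by (simp add: alternating_theta_0 bounded_gf_0 shanks_sum_def)
next
  case (Suc n)
  define q Q r where "q = (fps_X ^ Suc n :: int fps)" and "Q = (fps_X ^ (Suc n * Suc n) :: int fps)"
    and "r = (-1 :: int fps) ^ n"
  note [simp del] = power_Suc mult_Suc mult_Suc_right
  have recursion: "(1 - q) * bounded_gf (Suc n) = (1 + q) * bounded_gf n"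
    unfolding q_def by (rule one_minus_X_power_times_bounded_gf)
  have "fps_X ^ (Suc (Suc n) * Suc n) = q * Q"
    unfolding q_def Q_def power_add[symmetric] by (simp only: mult_Suc)
  then have "(1 - q) * (1 + shanks_sum (Suc n) (Suc n))
      = (1 + q) * (1 + shanks_sum n (Suc n)) + 2 * r * (q * Q) * bounded_gf (Suc n)"
    using shanks_sum_telescope[of n "Suc n"] by (simp add: q_def r_def power_Suc)
  also have "1 + shanks_sum n (Suc n)
      = alternating_theta n * bounded_gf n - r * Q * (bounded_gf (Suc n) + bounded_gf n)"
    by (simp only: shanks_sum_Suc Suc.IH Q_def r_def add_diff_eq)
  also have "(1 + q) * \<dots> + 2 * r * (q * Q) * bounded_gf (Suc n)
      = alternating_theta n * ((1 + q) * bounded_gf n) - r * Q * ((1 + q) * bounded_gf n)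
        - r * Q * ((1 - q) * bounded_gf (Suc n))"
    by (simp add: algebra_simps)
  also have "\<dots> = (1 - q) * ((alternating_theta n - 2 * r * Q) * bounded_gf (Suc n))"
    unfolding recursion[symmetric] by (simp add: algebra_simps)
  also have "alternating_theta n - 2 * r * Q = alternating_theta (Suc n)"
    by (simp add: alternating_theta_Suc Q_def r_def power2_eq_square)
  finally have "(1 - q) * (1 + shanks_sum (Suc n) (Suc n))
      = (1 - q) * (alternating_theta (Suc n) * bounded_gf (Suc n))" .
  moreover have "fps_nth (1 - q) 0 \<noteq> 0" by (simp add: q_def)
  then have "1 - q \<noteq> 0" by (metis fps_zero_nth)
  ultimately show ?case by (metis mult_left_cancel)
qed

definition theta :: "int fps" where
  "theta = Abs_fps (\<lambda>k. int (card {x :: int. x\<^sup>2 = int k}))"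

lemma abs_le_power2: "\<bar>x :: int\<bar> \<le> x\<^sup>2"
  using self_le_power[of "\<bar>x\<bar>" 2] by (cases "x = 0") auto

lemma alternating_theta_nth:
  assumes "k \<le> n"
  shows "fps_nth (alternating_theta n) k = (-1) ^ k * fps_nth theta k"
proof -
  have roots: "{x \<in> {- int n..int n}. nat (x\<^sup>2) = k} = {x. x\<^sup>2 = int k}"
  proof -
    have "\<bar>x\<bar> \<le> int n" if "x\<^sup>2 = int k" for x
      using abs_le_power2[of x] that assms by simp
    then show ?thesis by (force simp: abs_le_iff)
  qed
  have sign: "(-1) ^ nat \<bar>x\<bar> = (-1 :: int) ^ k" if "x\<^sup>2 = int k" for x
  proof -
    have "even (nat \<bar>x\<bar>) \<longleftrightarrow> even (x\<^sup>2)" by (simp add: even_nat_iff)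
    then show ?thesis using that by (simp add: minus_one_power_iff)
  qed
  have "fps_nth ((-1) ^ m * f) k = (-1) ^ m * fps_nth f k" for m and f :: "int fps"
    by (simp add: minus_one_power_iff)
  then have "fps_nth (alternating_theta n) k
      = (\<Sum>x\<in>{- int n..int n}. if nat (x\<^sup>2) = k then (-1) ^ nat \<bar>x\<bar> else 0)"
    unfolding alternating_theta_def fps_sum_nth by (intro sum.cong) (auto simp: fps_X_power_nth)
  also have "\<dots> = (\<Sum>x\<in>{x. x\<^sup>2 = int k}. (-1) ^ nat \<bar>x\<bar>)"
    unfolding roots[symmetric] by (rule sum.inter_filter[symmetric]) simp
  also have "\<dots> = (-1) ^ k * fps_nth theta k"
    by (simp add: sign theta_def)
  finally show ?thesis .
qed

text \<open>The signs are chosen such that the inverse is \<open>\<theta>(q)\<close> rather than \<open>\<theta>(-q)\<close>.\<close>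

definition signed_overpartition_gf :: "int fps" where
  "signed_overpartition_gf = Abs_fps (\<lambda>n. (-1) ^ n * int (overpartition_count n))"

theorem signed_overpartition_gf_times_theta: "signed_overpartition_gf * theta = 1"
proof (rule fps_ext)
  fix k
  have summand: "fps_nth signed_overpartition_gf i * fps_nth theta (k - i)
      = (-1) ^ k * (fps_nth (bounded_gf k) i * fps_nth (alternating_theta k) (k - i))"
    if "i \<le> k" for i
    using that
    by (simp add: signed_overpartition_gf_def bounded_gf_def overpartition_count_def
        alternating_theta_nth bounded_overpartitions_eq_overpartitions minus_one_power_iff)
  have "fps_nth (signed_overpartition_gf * theta) k
      = (-1) ^ k * fps_nth (bounded_gf k * alternating_theta k) k"
    unfolding fps_mult_nth sum_distrib_left by (intro sum.cong) (auto simp: summand)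
  also have "\<dots> = (-1) ^ k * fps_nth (1 + shanks_sum k k) k"
    by (simp only: mult.commute[of "bounded_gf k"] alternating_theta_times_bounded_gf)
  also have "fps_nth (shanks_sum k k) k = 0"
  proof -
    have "fps_nth ((-1) ^ s * fps_X ^ (s * Suc k) * f) k = (0 :: int)" if "1 \<le> s" for s f
    proof -
      have "k < s * Suc k" using mult_le_mono1[OF that, of "Suc k"] by simp
      then show ?thesis
        by (simp add: mult.assoc mult.left_commute[of "(-1) ^ s"] fps_X_power_mult_nth
              del: mult_Suc_right)
    qed
    then show ?thesis by (simp add: shanks_sum_def fps_sum_nth del: mult_Suc_right)
  qed
  then have "(-1) ^ k * fps_nth (1 + shanks_sum k k) k = fps_nth 1 k" by simp
  finally show "fps_nth (signed_overpartition_gf * theta) k = fps_nth 1 k" .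
qed

section \<open>Overpartitions of multiples of 3 and sums of five squares\<close>

definition dilate :: "nat \<Rightarrow> 'a :: idom fps \<Rightarrow> 'a fps" where
  "dilate m F = F oo fps_X ^ m"

lemma dilate_nth: "fps_nth (dilate m F) n = (if m dvd n then fps_nth F (n div m) else 0)"
  by (simp add: dilate_def fps_nth_compose_X_power)

lemma dilate_X: "0 < m \<Longrightarrow> dilate m fps_X = fps_X ^ m"
  by (simp add: dilate_def)

lemma dilate_const: "dilate m (fps_const c) = fps_const c"
  by (simp add: dilate_def)

lemma dilate_add: "dilate m (F + G) = dilate m F + dilate m G"
  by (simp add: dilate_def fps_compose_add_distrib)

lemma dilate_mult: "0 < m \<Longrightarrow> dilate m (F * G) = dilate m F * dilate m G"
  by (simp add: dilate_def fps_compose_mult_distrib)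

lemma dilate_power: "0 < m \<Longrightarrow> dilate m (F ^ k) = dilate m F ^ k"
  by (simp add: dilate_def fps_compose_power)

definition multisect :: "nat \<Rightarrow> 'a fps \<Rightarrow> 'a fps" where
  "multisect m F = Abs_fps (\<lambda>n. fps_nth F (m * n))"

lemma multisect_dilate_mult:
  assumes "0 < m" shows "multisect m (dilate m F * G) = F * multisect m G"
proof (rule fps_ext)
  fix n
  have "fps_nth (multisect m (dilate m F * G)) n
      = (\<Sum>i\<in>{0..m * n}. if m dvd i then fps_nth F (i div m) * fps_nth G (m * n - i) else 0)"
    by (auto simp: multisect_def fps_mult_nth dilate_nth intro: sum.cong)
  also have "\<dots> = (\<Sum>i\<in>(*) m ` {0..n}. fps_nth F (i div m) * fps_nth G (m * n - i))"
    using assms by (intro sum.mono_neutral_cong_right) (auto simp: dvd_def)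
  also have "\<dots> = (\<Sum>j=0..n. fps_nth F j * fps_nth G (m * (n - j)))"
    using assms by (subst sum.reindex) (auto simp: inj_on_def right_diff_distrib')
  also have "\<dots> = fps_nth (F * multisect m G) n"
    by (simp add: multisect_def fps_mult_nth)
  finally show "fps_nth (multisect m (dilate m F * G)) n = fps_nth (F * multisect m G) n" .
qed

lemma multisect_dilate: "0 < m \<Longrightarrow> multisect m (dilate m F) = F"
  by (rule fps_ext) (simp add: multisect_def dilate_nth)

lemma inj_dilate: "0 < m \<Longrightarrow> inj (dilate m)"
  by (metis injI multisect_dilate)

lemma multisect_add: "multisect m (F + G) = multisect m F + multisect m G"
  by (rule fps_ext) (simp add: multisect_def)

lemma multisect_diff: "multisect m (F - G) = multisect m F - multisect m G"
  by (rule fps_ext) (simp add: multisect_def)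

lemma multisect_X_power_dilate:
  assumes "\<not> m dvd r" shows "multisect m (fps_X ^ r * dilate m F) = 0"
proof (rule fps_ext)
  fix n
  have "\<not> m dvd m * n - r" if "r \<le> m * n"
    using that assms by (metis dvd_diffD1 dvd_triv_left)
  then show "fps_nth (multisect m (fps_X ^ r * dilate m F)) n = fps_nth 0 n"
    by (auto simp: multisect_def fps_X_power_mult_nth dilate_nth)
qed

definition graded :: "'a set \<Rightarrow> ('a \<Rightarrow> int) \<Rightarrow> bool" where
  "graded A f \<longleftrightarrow> (\<forall>x\<in>A. 0 \<le> f x) \<and> (\<forall>k. finite {x \<in> A. f x = int k})"

definition counting_fps :: "'a set \<Rightarrow> ('a \<Rightarrow> int) \<Rightarrow> int fps" where
  "counting_fps A f = Abs_fps (\<lambda>k. int (card {x \<in> A. f x = int k}))"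

lemma fiber_Times:
  assumes "graded A f" "graded B g"
  shows "{z \<in> A \<times> B. (case z of (x, y) \<Rightarrow> f x + g y) = int k}
    = (\<Union>i\<in>{0..k}. {x \<in> A. f x = int i} \<times> {y \<in> B. g y = int (k - i)})" (is "?L = ?R")
proof (intro equalityI subsetI)
  fix z assume z: "z \<in> ?L"
  obtain x y where xy: "z = (x, y)" by (cases z)
  have "0 \<le> f x" "0 \<le> g y" "f x + g y = int k" using z assms by (auto simp: xy graded_def)
  then have "nat (f x) \<in> {0..k}" "f x = int (nat (f x))" "g y = int (k - nat (f x))" by auto
  moreover have "x \<in> A" "y \<in> B" using z by (auto simp: xy)
  ultimately have "z \<in> {x \<in> A. f x = int (nat (f x))} \<times> {y \<in> B. g y = int (k - nat (f x))}"
    by (simp add: xy)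
  then show "z \<in> ?R" using \<open>nat (f x) \<in> {0..k}\<close> \<open>f x = int (nat (f x))\<close>
    by (intro UN_I[of "nat (f x)"]) (auto simp: xy)
qed auto

lemma graded_Times:
  assumes "graded A f" "graded B g"
  shows "graded (A \<times> B) (\<lambda>(x, y). f x + g y)"
proof -
  have "finite ({x \<in> A. f x = int i} \<times> {y \<in> B. g y = int j})" for i j
    using assms by (intro finite_cartesian_product) (auto simp: graded_def)
  then have "finite (\<Union>i\<in>{0..k}. {x \<in> A. f x = int i} \<times> {y \<in> B. g y = int (k - i)})" for k by blast
  then show ?thesis
    using assms unfolding graded_def[of "A \<times> B"] fiber_Times[OF assms] by (auto simp: graded_def)
qed

lemma counting_fps_Times:
  assumes "graded A f" "graded B g"
  shows "counting_fps (A \<times> B) (\<lambda>(x, y). f x + g y) = counting_fps A f * counting_fps B g"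
proof (rule fps_ext)
  fix k
  have "card {z \<in> A \<times> B. (case z of (x, y) \<Rightarrow> f x + g y) = int k}
     = (\<Sum>i\<in>{0..k}. card ({x \<in> A. f x = int i} \<times> {y \<in> B. g y = int (k - i)}))"
    unfolding fiber_Times[OF assms]
  proof (intro card_UN_disjoint ballI impI)
    show "finite ({x \<in> A. f x = int i} \<times> {y \<in> B. g y = int (k - i)})" for i
      using assms by (intro finite_cartesian_product) (auto simp: graded_def simp del: of_nat_diff)
  qed auto
  then show "fps_nth (counting_fps (A \<times> B) (\<lambda>(x, y). f x + g y)) k
      = fps_nth (counting_fps A f * counting_fps B g) k"
    by (simp add: counting_fps_def fps_mult_nth card_cartesian_product del: of_nat_diff)
qed

lemma counting_fps_bij_betw:
  assumes "bij_betw h A B" "\<And>x. x \<in> A \<Longrightarrow> f (h x) = g x"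
  shows "counting_fps A g = counting_fps B f"
proof -
  have "bij_betw h {x \<in> A. g x = int k} {y \<in> B. f y = int k}" for k
    using assms by (auto simp: bij_betw_def inj_on_def)
  then have "card {x \<in> A. g x = int k} = card {y \<in> B. f y = int k}" for k
    by (rule bij_betw_same_card)
  then show ?thesis by (simp add: counting_fps_def)
qed

lemma graded_subset:
  assumes "graded B f" "A \<subseteq> B" shows "graded A f"
proof -
  have "finite {x \<in> A. f x = int k}" for k
  proof (rule finite_subset)
    show "{x \<in> A. f x = int k} \<subseteq> {x \<in> B. f x = int k}" using assms(2) by blast
    show "finite {x \<in> B. f x = int k}" using assms(1) unfolding graded_def by blast
  qed
  moreover have "\<forall>x\<in>A. 0 \<le> f x" using assms unfolding graded_def by blast
  ultimately show ?thesis unfolding graded_def by blast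
qed

lemma counting_fps_UN:
  assumes "finite I" "graded (\<Union>i\<in>I. A i) f" "\<And>i j. i \<in> I \<Longrightarrow> j \<in> I \<Longrightarrow> i \<noteq> j \<Longrightarrow> A i \<inter> A j = {}"
  shows "counting_fps (\<Union>i\<in>I. A i) f = (\<Sum>i\<in>I. counting_fps (A i) f)"
proof (rule fps_ext)
  fix k
  have "{x \<in> (\<Union>i\<in>I. A i). f x = int k} = (\<Union>i\<in>I. {x \<in> A i. f x = int k})" by auto
  moreover have "finite {x \<in> A i. f x = int k}" if "i \<in> I" for i
    using graded_subset[OF assms(2), of "A i"] that by (auto simp: graded_def)
  moreover have "{x \<in> A i. f x = int k} \<inter> {x \<in> A j. f x = int k} = {}"
    if "i \<in> I" "j \<in> I" "i \<noteq> j" for i j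
    using assms(3)[OF that] by auto
  ultimately have "card {x \<in> (\<Union>i\<in>I. A i). f x = int k} = (\<Sum>i\<in>I. card {x \<in> A i. f x = int k})"
    using assms(1) by (simp add: card_UN_disjoint)
  then show "fps_nth (counting_fps (\<Union>i\<in>I. A i) f) k = fps_nth (\<Sum>i\<in>I. counting_fps (A i) f) k"
    by (simp add: counting_fps_def fps_sum_nth)
qed

lemma graded_square: "graded (A :: int set) (\<lambda>x. x\<^sup>2)"
proof -
  have "\<bar>x\<bar> \<le> int k" if "x\<^sup>2 = int k" for x k using abs_le_power2[of x] that by simp
  then have "{x \<in> A. x\<^sup>2 = int k} \<subseteq> {- int k..int k}" for k by (force simp: abs_le_iff)
  then show ?thesis by (auto simp: graded_def intro: finite_subset[OF _ finite_atLeastAtMost_int])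
qed

lemma theta_eq_counting_fps: "theta = counting_fps UNIV (\<lambda>x. x\<^sup>2)"
  by (simp add: theta_def counting_fps_def)

lemma counting_fps_scale:
  assumes "0 < m" shows "counting_fps A (\<lambda>x. int m * f x) = dilate m (counting_fps A f)"
proof (rule fps_ext)
  fix k
  have "int m * z = int k \<longleftrightarrow> m dvd k \<and> z = int (k div m)" for z
    using assms by (metis dvd_mult_div_cancel dvd_triv_left int_dvd_int_iff neq0_conv
        nonzero_mult_div_cancel_left of_nat_eq_0_iff of_nat_mult zdiv_int)
  then show "fps_nth (counting_fps A (\<lambda>x. int m * f x)) k = fps_nth (dilate m (counting_fps A f)) k"
    using assms by (simp add: counting_fps_def dilate_nth)
qed

definition residue_theta :: "int \<Rightarrow> int fps" where
  "residue_theta r = counting_fps {x. x mod 3 = r} (\<lambda>x. x\<^sup>2)"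

lemma residue_theta_0: "residue_theta 0 = dilate 3 (dilate 3 theta)"
proof -
  have "bij_betw (\<lambda>x. 3 * x) UNIV {x :: int. x mod 3 = 0}"
    by (rule bij_betw_byWitness[where f' = "\<lambda>x. x div 3"]) auto
  then have "counting_fps UNIV (\<lambda>x :: int. int 3 * (int 3 * x\<^sup>2)) = residue_theta 0"
    unfolding residue_theta_def by (rule counting_fps_bij_betw) (simp add: power2_eq_square)
  then show ?thesis by (simp only: theta_eq_counting_fps counting_fps_scale zero_less_numeral)
qed

lemma residue_theta_2: "residue_theta 2 = residue_theta 1"
proof -
  have "bij_betw uminus {x :: int. x mod 3 = 2} {x. x mod 3 = 1}"
    by (rule bij_betw_byWitness[where f' = uminus]) (auto, presburger+)
  then show ?thesis
    unfolding residue_theta_def by (rule counting_fps_bij_betw) simp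
qed

lemma theta_eq_sum_residue_theta: "theta = residue_theta 0 + 2 * residue_theta 1"
proof -
  have "(\<Union>r\<in>{0, 1, 2}. {x :: int. x mod 3 = r}) = UNIV"
    by auto
  then have "theta = (\<Sum>r\<in>{0, 1, 2}. counting_fps {x :: int. x mod 3 = r} (\<lambda>x. x\<^sup>2))"
    unfolding theta_eq_counting_fps by (subst counting_fps_UN[symmetric]) (auto simp: graded_square)
  then show ?thesis by (simp add: residue_theta_2 flip: residue_theta_def)
qed

lemma residue_theta_nth_eq_0:
  assumes "int n mod 3 \<noteq> r\<^sup>2 mod 3" shows "fps_nth (residue_theta r) n = 0"
proof -
  have "x\<^sup>2 \<noteq> int n" if "x mod 3 = r" for x
    using assms that by (metis power_mod)
  then have "{x \<in> {x. x mod 3 = r}. x\<^sup>2 = int n} = {}" by blast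
  then show ?thesis
    by (simp only: residue_theta_def counting_fps_def fps_nth_Abs_fps card.empty of_nat_0)
qed

definition offset_theta :: "int fps" where
  "offset_theta = Abs_fps (\<lambda>n. fps_nth theta (3 * n + 1))"

lemma two_residue_theta_1: "2 * residue_theta 1 = fps_X * dilate 3 offset_theta"
proof (rule fps_ext)
  fix n
  show "fps_nth (2 * residue_theta 1) n = fps_nth (fps_X * dilate 3 offset_theta) n"
  proof (cases "n mod 3 = 1")
    case True
    then obtain m where m: "n = 3 * m + 1" by (metis mult_div_mod_eq)
    then have "fps_nth (residue_theta 0) n = 0" by (intro residue_theta_nth_eq_0) simp
    then have "fps_nth theta n = fps_nth (2 * residue_theta 1) n"
      by (simp add: theta_eq_sum_residue_theta)
    then show ?thesis by (simp add: m offset_theta_def dilate_nth)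
  next
    case False
    then have "int n mod 3 \<noteq> 1\<^sup>2 mod 3" by (simp; presburger)
    then have "fps_nth (residue_theta 1) n = 0" by (rule residue_theta_nth_eq_0)
    moreover have "\<not> 3 dvd n - 1" if "n \<noteq> 0" using that False by presburger
    ultimately show ?thesis by (auto simp: dilate_nth numeral_fps_const)
  qed
qed

lemma theta_dissection: "theta = dilate 3 (dilate 3 theta) + fps_X * dilate 3 offset_theta"
  using theta_eq_sum_residue_theta by (simp only: residue_theta_0 two_residue_theta_1)

definition norm4 :: "int \<times> int \<times> int \<times> int \<Rightarrow> int" where
  "norm4 = (\<lambda>(a, b, c, d). a\<^sup>2 + (b\<^sup>2 + (c\<^sup>2 + d\<^sup>2)))"

lemma graded_norm4: "graded (A \<times> B \<times> C \<times> D) norm4"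
  and counting_fps_norm4: "counting_fps (A \<times> B \<times> C \<times> D) norm4 =
    counting_fps A (\<lambda>x. x\<^sup>2) * (counting_fps B (\<lambda>x. x\<^sup>2) *
      (counting_fps C (\<lambda>x. x\<^sup>2) * counting_fps D (\<lambda>x. x\<^sup>2)))"
proof -
  have nested: "norm4 = (\<lambda>(a, y). a\<^sup>2 + (case y of (b, z) \<Rightarrow> b\<^sup>2 + (case z of (c, d) \<Rightarrow> c\<^sup>2 + d\<^sup>2)))"
    by (auto simp: norm4_def)
  show "graded (A \<times> B \<times> C \<times> D) norm4"
    unfolding nested by (intro graded_Times graded_square)
  show "counting_fps (A \<times> B \<times> C \<times> D) norm4 =
    counting_fps A (\<lambda>x. x\<^sup>2) * (counting_fps B (\<lambda>x. x\<^sup>2) *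
      (counting_fps C (\<lambda>x. x\<^sup>2) * counting_fps D (\<lambda>x. x\<^sup>2)))"
    unfolding nested by (simp add: counting_fps_Times graded_Times graded_square)
qed

text \<open>The vectors whose reduction modulo 3 lies in the self-dual ternary code of length 4, in which
  every nonzero word has exactly three nonzero entries.\<close>

definition tetracode_lattice :: "(int \<times> int \<times> int \<times> int) set" where
  "tetracode_lattice = {(a, b, c, d). 3 dvd b + c + d \<and> 3 dvd a + c - d}"

definition tetracode_coset :: "int \<times> int \<Rightarrow> (int \<times> int \<times> int \<times> int) set" where
  "tetracode_coset = (\<lambda>(s, t). {x. x mod 3 = (t - s) mod 3} \<times> {x. x mod 3 = (- (s + t)) mod 3} \<times>
     {x. x mod 3 = s} \<times> {x. x mod 3 = t})"

lemma tetracode_lattice_eq_UN_cosets: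
  "tetracode_lattice = (\<Union>i\<in>{0, 1, 2} \<times> {0, 1, 2}. tetracode_coset i)"
proof -
  have mem: "(a, b, c, d) \<in> tetracode_lattice
      \<longleftrightarrow> (a, b, c, d) \<in> tetracode_coset (c mod 3, d mod 3)" for a b c d
  proof -
    have "(a, b, c, d) \<in> tetracode_lattice \<longleftrightarrow> a mod 3 = (d - c) mod 3 \<and> b mod 3 = (- (c + d)) mod 3"
      by (simp add: tetracode_lattice_def mod_eq_dvd_iff algebra_simps conj_commute)
    also have "(d - c) mod 3 = (d mod 3 - c mod 3) mod 3" by (simp add: mod_diff_eq)
    also have "(- (c + d)) mod 3 = (- (c mod 3 + d mod 3)) mod 3" by (metis mod_add_eq mod_minus_eq)
    finally show ?thesis by (simp add: tetracode_coset_def)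
  qed
  show ?thesis
  proof (intro equalityI subsetI)
    fix x assume "x \<in> tetracode_lattice"
    moreover obtain a b c d where "x = (a, b, c, d)" by (cases x)
    ultimately have "x \<in> tetracode_coset (c mod 3, d mod 3)" by (simp only: mem)
    moreover have "z mod 3 \<in> {0, 1, 2}" for z :: int by (simp; presburger)
    then have "(c mod 3, d mod 3) \<in> {0, 1, 2} \<times> {0, 1, 2}" by (intro SigmaI)
    ultimately show "x \<in> (\<Union>i\<in>{0, 1, 2} \<times> {0, 1, 2}. tetracode_coset i)" by (rule UN_I[rotated])
  next
    fix x assume "x \<in> (\<Union>i\<in>{0, 1, 2} \<times> {0, 1, 2}. tetracode_coset i)"
    then obtain s t where x: "x \<in> tetracode_coset (s, t)" by blast
    obtain a b c d where abcd: "x = (a, b, c, d)" by (cases x)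
    have "s = c mod 3" "t = d mod 3" using x by (simp_all add: abcd tetracode_coset_def)
    then show "x \<in> tetracode_lattice" using x by (simp only: abcd mem)
  qed
qed

lemma counting_fps_tetracode_coset:
  "counting_fps (tetracode_coset (s, t)) norm4 = residue_theta ((t - s) mod 3) *
     (residue_theta ((- (s + t)) mod 3) * (residue_theta s * residue_theta t))"
  by (simp only: tetracode_coset_def prod.case residue_theta_def counting_fps_norm4)

lemma counting_fps_tetracode_lattice:
  "counting_fps tetracode_lattice norm4
      = residue_theta 0 ^ 4 + 8 * residue_theta 0 * residue_theta 1 ^ 3"
proof -
  let ?I = "{0, 1, 2} \<times> {0, 1, 2} :: (int \<times> int) set"
  have "graded (UNIV \<times> UNIV \<times> UNIV \<times> UNIV) norm4" by (rule graded_norm4)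
  then have "graded (\<Union>i\<in>?I. tetracode_coset i) norm4" by (rule graded_subset) simp
  moreover have "tetracode_coset i \<inter> tetracode_coset j = {}" if "i \<noteq> j" for i j
    using that by (cases i, cases j) (auto simp: tetracode_coset_def)
  ultimately have "counting_fps tetracode_lattice norm4
      = (\<Sum>i\<in>?I. counting_fps (tetracode_coset i) norm4)"
    unfolding tetracode_lattice_eq_UN_cosets by (intro counting_fps_UN) simp_all
  also have "\<dots> = (\<Sum>s\<in>{0, 1, 2}. \<Sum>t\<in>{0, 1, 2}. counting_fps (tetracode_coset (s, t)) norm4)"
    by (simp add: sum.cartesian_product)
  also have "\<dots> = residue_theta 0 ^ 4 + 8 * residue_theta 0 * residue_theta 1 ^ 3"
    by (simp add: counting_fps_tetracode_coset residue_theta_2 power4_eq_xxxx power3_eq_cube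
        algebra_simps)
  finally show ?thesis .
qed

lemma counting_fps_tetracode_lattice_eq_dilate:
  "counting_fps tetracode_lattice norm4 = dilate 3 (theta ^ 4)"
proof -
  let ?h = "\<lambda>(a, b, c, d). (b + c + d, a - c + d, a + b - d, a - b + c) :: int \<times> int \<times> int \<times> int"
  let ?g = "\<lambda>(a, b, c, d). ((b + c + d) div 3, (a + c - d) div 3, (a - b + d) div 3,
    (a + b - c) div 3) :: int \<times> int \<times> int \<times> int"
  have "bij_betw ?h UNIV tetracode_lattice"
  proof (rule bij_betw_byWitness[where f' = ?g])
    show "\<forall>x\<in>UNIV. ?g (?h x) = x" by auto
    show "\<forall>x\<in>tetracode_lattice. ?h (?g x) = x"
    proof
      fix x assume x: "x \<in> tetracode_lattice"
      obtain a b c d where abcd: "x = (a, b, c, d)" by (cases x)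
      obtain u v where uv: "b + c + d = 3 * u" "a + c - d = 3 * v"
        using x unfolding abcd tetracode_lattice_def by (auto elim!: dvdE)
      then have eqs: "a - b + d = 3 * (v - u + d)" "a + b - c = 3 * (u + v - c)" by auto
      have "(b + c + d) div 3 = u" "(a + c - d) div 3 = v" "(a - b + d) div 3 = v - u + d"
        "(a + b - c) div 3 = u + v - c" unfolding uv eqs by simp_all
      then show "?h (?g x) = x" unfolding abcd prod.case using uv by auto
    qed
    show "?h ` UNIV \<subseteq> tetracode_lattice" unfolding tetracode_lattice_def by (auto; presburger)
  qed auto
  then have "counting_fps UNIV (\<lambda>x. int 3 * norm4 x) = counting_fps tetracode_lattice norm4"
    by (rule counting_fps_bij_betw) (auto simp: norm4_def power2_eq_square algebra_simps)
  moreover have "counting_fps UNIV norm4 = theta ^ 4"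
    using counting_fps_norm4[of UNIV UNIV UNIV UNIV]
    by (simp add: theta_eq_counting_fps power4_eq_xxxx mult.assoc)
  ultimately show ?thesis using counting_fps_scale[of 3 UNIV norm4] by simp
qed

lemma theta_power4: "theta ^ 4 = dilate 3 theta * (dilate 3 theta ^ 3 + fps_X * offset_theta ^ 3)"
proof (rule injD[OF inj_dilate[of 3]])
  have "8 * residue_theta 0 * residue_theta 1 ^ 3 = residue_theta 0 * (2 * residue_theta 1) ^ 3"
    by (simp add: power_mult_distrib)
  then have "dilate 3 (theta ^ 4)
      = residue_theta 0 ^ 4 + residue_theta 0 * (2 * residue_theta 1) ^ 3"
    using counting_fps_tetracode_lattice by (simp only: counting_fps_tetracode_lattice_eq_dilate)
  also have "\<dots> = dilate 3 (dilate 3 theta * (dilate 3 theta ^ 3 + fps_X * offset_theta ^ 3))"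
    unfolding residue_theta_0 two_residue_theta_1
    by (simp add: dilate_mult dilate_add dilate_power dilate_X power_mult_distrib power3_eq_cube
        power4_eq_xxxx algebra_simps)
  finally show "dilate 3 (theta ^ 4)
      = dilate 3 (dilate 3 theta * (dilate 3 theta ^ 3 + fps_X * offset_theta ^ 3))" .
qed simp

text \<open>The 3-dissection \<open>\<theta> = A + q B\<close> is inverted by
  \<open>(A + q B) (A\<^sup>2 - q A B + q\<^sup>2 B\<^sup>2) = A\<^sup>3 + q\<^sup>3 B\<^sup>3\<close>.\<close>

lemma multisect_signed_overpartition_gf:
  "multisect 3 signed_overpartition_gf * theta ^ 4 = dilate 3 theta ^ 3"
proof -
  define a b where "a = dilate 3 theta" and "b = offset_theta"
  let ?A = "dilate 3 a" and ?B = "dilate 3 b"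
  have dissection: "theta = ?A + fps_X * ?B" by (simp only: a_def b_def flip: theta_dissection)
  have "dilate 3 (a ^ 3 + fps_X * b ^ 3) = ?A ^ 3 + fps_X ^ 3 * ?B ^ 3"
    by (simp add: dilate_add dilate_mult dilate_power dilate_X)
  also have "\<dots> = (?A + fps_X * ?B) * (?A ^ 2 - fps_X * (?A * ?B) + fps_X ^ 2 * ?B ^ 2)"
    by (simp add: power2_eq_square power3_eq_cube algebra_simps)
  also have "?A ^ 2 - fps_X * (?A * ?B) + fps_X ^ 2 * ?B ^ 2
      = dilate 3 (a ^ 2) - fps_X ^ 1 * dilate 3 (a * b) + fps_X ^ 2 * dilate 3 (b ^ 2)"
    by (simp add: dilate_mult dilate_power)
  finally have "dilate 3 (a ^ 3 + fps_X * b ^ 3) * signed_overpartition_gf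
      = (signed_overpartition_gf * theta)
        * (dilate 3 (a ^ 2) - fps_X ^ 1 * dilate 3 (a * b) + fps_X ^ 2 * dilate 3 (b ^ 2))"
    by (simp only: dissection[symmetric] ac_simps)
  then have "multisect 3 (dilate 3 (a ^ 3 + fps_X * b ^ 3) * signed_overpartition_gf) =
      multisect 3 (dilate 3 (a ^ 2)) - multisect 3 (fps_X ^ 1 * dilate 3 (a * b))
        + multisect 3 (fps_X ^ 2 * dilate 3 (b ^ 2))"
    by (simp only: signed_overpartition_gf_times_theta mult_1 multisect_add multisect_diff)
  then have "(a ^ 3 + fps_X * b ^ 3) * multisect 3 signed_overpartition_gf = a ^ 2"
    using multisect_X_power_dilate[of 3 1 "a * b"]
    by (simp add: multisect_dilate_mult multisect_dilate multisect_X_power_dilate)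
  then have "a * ((a ^ 3 + fps_X * b ^ 3) * multisect 3 signed_overpartition_gf) = a ^ 3"
    by (simp add: power2_eq_square power3_eq_cube)
  then show ?thesis by (simp add: theta_power4 a_def b_def ac_simps)
qed

lemma prime_dvd_power_add_diff:
  fixes a b :: "'a :: comm_ring_1"
  assumes "prime p" shows "of_nat p dvd (a + b) ^ p - (a ^ p + b ^ p)"
proof -
  have "0 < p" using assms by (rule prime_gt_0_nat)
  have "(a + b) ^ p = (\<Sum>k\<in>{..p}. of_nat (p choose k) * a ^ k * b ^ (p - k))"
    by (rule binomial_ring)
  also have "{..p} = insert 0 (insert p {0<..<p})" by auto
  also have "(\<Sum>k\<in>\<dots>. of_nat (p choose k) * a ^ k * b ^ (p - k))
      = b ^ p + (a ^ p + (\<Sum>k\<in>{0<..<p}. of_nat (p choose k) * a ^ k * b ^ (p - k)))"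
    using \<open>0 < p\<close> by simp
  finally have "(a + b) ^ p - (a ^ p + b ^ p)
      = (\<Sum>k\<in>{0<..<p}. of_nat (p choose k) * a ^ k * b ^ (p - k))"
    by simp
  also have "of_nat p dvd \<dots>"
  proof (intro dvd_sum dvd_mult2)
    fix k assume "k \<in> {0<..<p}"
    then have "p dvd p choose k" using assms by (intro dvd_choose_prime) auto
    then show "of_nat p dvd (of_nat (p choose k) :: 'a)" by (metis dvd_def of_nat_mult)
  qed
  finally show ?thesis .
qed

lemma prime_dvd_power_diff_self:
  fixes c :: int
  assumes "prime p" shows "int p dvd c ^ p - c"
proof (induction c rule: int_induct[of _ 0])
  case base
  then show ?case using assms by (simp add: power_0_left)
next
  case (step1 c)
  then show ?case
    using dvd_add[OF prime_dvd_power_add_diff[OF assms, of c 1] step1(2)]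
    by (simp add: algebra_simps)
next
  case (step2 c)
  then show ?case
    using dvd_diff[OF step2(2) prime_dvd_power_add_diff[OF assms, of "c - 1" 1]]
    by (simp add: algebra_simps)
qed

lemma fps_const_dvd_iff: "fps_const c dvd F \<longleftrightarrow> (\<forall>n. c dvd fps_nth F n)"
proof
  assume "\<forall>n. c dvd fps_nth F n"
  then obtain h where "\<And>n. fps_nth F n = c * h n" unfolding dvd_def by metis
  then have "F = fps_const c * Abs_fps h" by (intro fps_ext) simp
  then show "fps_const c dvd F" by simp
qed (auto simp: dvd_def)

lemma prime_dvd_fps_cutoff_power_diff_dilate:
  fixes F :: "int fps"
  assumes "prime p"
  shows "of_nat p dvd fps_cutoff N F ^ p - dilate p (fps_cutoff N F)"
proof (induction N)
  case 0
  have "0 < p" using assms by (rule prime_gt_0_nat)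
  then show ?case by (simp add: dilate_def power_0_left)
next
  case (Suc N)
  have p0: "0 < p" using assms by (rule prime_gt_0_nat)
  define T u where "T = fps_cutoff N F" and "u = fps_const (fps_nth F N) * fps_X ^ N"
  have cutoff_Suc: "fps_cutoff (Suc N) F = T + u"
    by (rule fps_ext) (auto simp: T_def u_def less_Suc_eq fps_X_power_nth)
  have "u ^ p - dilate p u = fps_const (fps_nth F N ^ p - fps_nth F N) * fps_X ^ (N * p)"
    using p0
    by (simp add: u_def power_mult_distrib dilate_mult dilate_power dilate_X dilate_const
        fps_const_power left_diff_distrib mult.commute[of N] flip: power_mult fps_const_sub)
  moreover have "of_nat p dvd fps_const (fps_nth F N ^ p - fps_nth F N)"
    using prime_dvd_power_diff_self[OF assms] by (simp add: fps_const_dvd_iff flip: fps_of_nat)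
  ultimately have "of_nat p dvd u ^ p - dilate p u" by simp
  then have
    "of_nat p dvd (T ^ p - dilate p T) + (u ^ p - dilate p u) + ((T + u) ^ p - (T ^ p + u ^ p))"
    using Suc.IH unfolding T_def[symmetric] by (intro dvd_add prime_dvd_power_add_diff[OF assms])
  then show ?case unfolding cutoff_Suc by (simp add: dilate_add algebra_simps)
qed

lemma fps_cutoff_power_nth: "i < n \<Longrightarrow> fps_nth (fps_cutoff n F ^ k) i = fps_nth (F ^ k) i"
  by (induction k arbitrary: i) (auto simp: fps_mult_nth intro!: sum.cong)

lemma prime_dvd_fps_power_diff_dilate:
  fixes F :: "int fps"
  assumes "prime p" shows "of_nat p dvd F ^ p - dilate p F"
proof -
  have p0: "0 < p" using assms by (rule prime_gt_0_nat)
  have "int p dvd fps_nth (F ^ p - dilate p F) n" for n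
  proof -
    let ?T = "fps_cutoff (Suc n) F"
    have "fps_nth (F ^ p) n = fps_nth (?T ^ p) n" by (simp add: fps_cutoff_power_nth)
    moreover have "n div p < Suc n" by (simp add: le_imp_less_Suc)
    then have "fps_nth (dilate p F) n = fps_nth (dilate p ?T) n"
      using p0 by (simp add: dilate_nth)
    moreover have "int p dvd fps_nth (?T ^ p - dilate p ?T) n"
      using prime_dvd_fps_cutoff_power_diff_dilate[OF assms, of "Suc n" F]
      by (simp add: fps_const_dvd_iff del: fps_cutoff_nth flip: fps_of_nat)
    ultimately show ?thesis by simp
  qed
  then show ?thesis by (simp add: fps_const_dvd_iff flip: fps_of_nat)
qed

lemma nine_dvd_cube_diff:
  fixes x y :: "'a :: comm_ring_1"
  assumes "3 dvd x - y" shows "9 dvd x ^ 3 - y ^ 3"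
proof -
  obtain t where "x - y = 3 * t" using assms by (elim dvdE)
  then have "x = y + 3 * t" by (simp add: algebra_simps)
  then have "x ^ 3 - y ^ 3 = 9 * (y\<^sup>2 * t + 3 * y * t\<^sup>2 + 3 * t ^ 3)"
    by (simp add: power2_eq_square power3_eq_cube algebra_simps)
  then show ?thesis by (rule dvdI)
qed

lemma dvd_dilate_cube_diff_power9:
  fixes F :: "int fps"
  shows "9 dvd dilate 3 F ^ 3 - F ^ 9"
proof -
  have "3 dvd dilate 3 F - F ^ 3"
    using prime_dvd_fps_power_diff_dilate[of 3 F]
      dvd_minus_iff[of 3 "F ^ 3 - dilate 3 F"] by simp
  then have "9 dvd dilate 3 F ^ 3 - (F ^ 3) ^ 3" by (rule nine_dvd_cube_diff)
  then show ?thesis by (simp flip: power_mult)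
qed

theorem overpartition_count_cong_theta:
  "[(-1) ^ n * int (overpartition_count (3 * n)) = fps_nth (theta ^ 5) n] (mod 9)"
proof -
  have inverse: "signed_overpartition_gf ^ 4 * theta ^ 4 = 1"
    by (simp add: signed_overpartition_gf_times_theta flip: power_mult_distrib)
  have "multisect 3 signed_overpartition_gf - theta ^ 5
      = (signed_overpartition_gf ^ 4 * theta ^ 4)
        * (multisect 3 signed_overpartition_gf - theta ^ 5)"
    by (simp add: inverse)
  also have "\<dots>
      = signed_overpartition_gf ^ 4 * (multisect 3 signed_overpartition_gf * theta ^ 4 - theta ^ 9)"
    by (simp add: algebra_simps flip: power_add)
  also have "9 dvd \<dots>"
    unfolding multisect_signed_overpartition_gf by (intro dvd_mult dvd_dilate_cube_diff_power9)
  finally have "9 dvd fps_nth (multisect 3 signed_overpartition_gf - theta ^ 5) n"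
    by (simp add: numeral_fps_const fps_const_dvd_iff)
  then show ?thesis
    by (simp add: cong_iff_dvd_diff multisect_def signed_overpartition_gf_def minus_one_power_iff)
qed

section \<open>Unimodular lattices of rank at most 5\<close>

lemma scalar_prod_self_int_pos:
  fixes v :: "int vec"
  assumes "v \<in> carrier_vec n" "v \<noteq> 0\<^sub>v n" shows "0 < v \<bullet> v"
proof -
  have "conjugate v = v" by (intro eq_vecI) (auto simp: conjugate_int_def)
  then show ?thesis using conjugate_square_greater_0_vec[OF assms(1)] assms(2) by simp
qed

lemma scalar_prod_self_int_nonneg: "0 \<le> (v :: int vec) \<bullet> v"
  unfolding scalar_prod_def by (intro sum_nonneg) simp

lemma scalar_prod_mult_mat_vec:
  fixes A :: "'a :: comm_semiring_0 mat"
  assumes A: "A \<in> carrier_mat nr nc" and x: "x \<in> carrier_vec nc" and y: "y \<in> carrier_vec nr"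
  shows "(A *\<^sub>v x) \<bullet> y = x \<bullet> (transpose_mat A *\<^sub>v y)"
proof -
  have "(A *\<^sub>v x) \<bullet> y = y \<bullet> (A *\<^sub>v x)" using A x y by (intro comm_scalar_prod[of _ nr]) auto
  also have "\<dots> = (transpose_mat A *\<^sub>v y) \<bullet> x" using transpose_vec_mult_scalar[OF A x y] ..
  also have "\<dots> = x \<bullet> (transpose_mat A *\<^sub>v y)" using A x y by (intro comm_scalar_prod[of _ nc]) auto
  finally show ?thesis .
qed

lemma mult_mat_vec_smult:
  fixes A :: "'a :: comm_ring_1 mat"
  assumes "A \<in> carrier_mat nr nc" "x \<in> carrier_vec nc"
  shows "A *\<^sub>v (c \<cdot>\<^sub>v x) = c \<cdot>\<^sub>v (A *\<^sub>v x)"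
  using assms by (intro eq_vecI) auto

lemma mult_mat_zero_vec: "A \<in> carrier_mat nr nc \<Longrightarrow> A *\<^sub>v 0\<^sub>v nc = 0\<^sub>v nr"
  for A :: "'a :: comm_ring_1 mat"
  by (intro eq_vecI) auto

definition quad :: "'a :: comm_ring_1 mat \<Rightarrow> 'a vec \<Rightarrow> 'a" where
  "quad G x = x \<bullet> (G *\<^sub>v x)"

lemma quad_smult:
  assumes "G \<in> carrier_mat n n" "x \<in> carrier_vec n"
  shows "quad G (c \<cdot>\<^sub>v x) = c\<^sup>2 * quad G x"
  using assms by (simp add: quad_def mult_mat_vec_smult power2_eq_square)

lemma quad_congruent:
  assumes "G \<in> carrier_mat n n" "U \<in> carrier_mat n n" "x \<in> carrier_vec n"
  shows "quad (transpose_mat U * G * U) x = quad G (U *\<^sub>v x)"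
proof -
  have "transpose_mat U * G * U *\<^sub>v x = transpose_mat U *\<^sub>v (G *\<^sub>v (U *\<^sub>v x))"
    using assms by (simp add: assoc_mult_mat_vec[of _ n n _ n])
  then show ?thesis
    using assms scalar_prod_mult_mat_vec[of U n n x "G *\<^sub>v (U *\<^sub>v x)"] by (simp add: quad_def)
qed

definition pos_def :: "nat \<Rightarrow> 'a :: linordered_idom mat \<Rightarrow> bool" where
  "pos_def n G \<longleftrightarrow> G \<in> carrier_mat n n \<and> transpose_mat G = G \<and>
     (\<forall>x\<in>carrier_vec n. x \<noteq> 0\<^sub>v n \<longrightarrow> 0 < quad G x)"

lemma pos_def_carrier: "pos_def n G \<Longrightarrow> G \<in> carrier_mat n n"
  by (simp add: pos_def_def)

lemma pos_def_transpose: "pos_def n G \<Longrightarrow> transpose_mat G = G"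
  by (simp add: pos_def_def)

lemma pos_def_quad_pos: "pos_def n G \<Longrightarrow> x \<in> carrier_vec n \<Longrightarrow> x \<noteq> 0\<^sub>v n \<Longrightarrow> 0 < quad G x"
  by (simp add: pos_def_def)

definition unimodular :: "nat \<Rightarrow> int mat \<Rightarrow> bool" where
  "unimodular n U \<longleftrightarrow> U \<in> carrier_mat n n \<and> \<bar>det U\<bar> = 1"

lemma unimodular_carrier: "unimodular n U \<Longrightarrow> U \<in> carrier_mat n n"
  by (simp add: unimodular_def)

lemma unimodular_one: "unimodular n (1\<^sub>m n)"
  by (auto simp: unimodular_def)

lemma unimodular_mult:
  "unimodular n U \<Longrightarrow> unimodular n V \<Longrightarrow> unimodular n (U * V)"
  by (auto simp: unimodular_def det_mult abs_mult)

lemma unimodular_inverse: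
  assumes "unimodular n U"
  obtains V where "V \<in> carrier_mat n n" "U * V = 1\<^sub>m n"
proof
  have U: "U \<in> carrier_mat n n" and "det U * det U = 1"
    using assms by (auto simp: unimodular_def abs_if split: if_splits)
  then show "U * (det U \<cdot>\<^sub>m adj_mat U) = 1\<^sub>m n" and "det U \<cdot>\<^sub>m adj_mat U \<in> carrier_mat n n"
    using adj_mat[OF U] by (auto simp: mult_smult_distrib[OF U])
qed

lemma image_unimodular:
  assumes "unimodular n U" shows "(*\<^sub>v) U ` carrier_vec n = carrier_vec n"
proof (intro equalityI subsetI)
  obtain V where V: "V \<in> carrier_mat n n" "U * V = 1\<^sub>m n" using unimodular_inverse[OF assms] .
  fix x :: "int vec" assume x: "x \<in> carrier_vec n"
  have "U *\<^sub>v (V *\<^sub>v x) = (U * V) *\<^sub>v x"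
    using unimodular_carrier[OF assms] V(1) x by (intro assoc_mult_mat_vec[symmetric])
  then have "x = U *\<^sub>v (V *\<^sub>v x)" using V x by simp
  moreover have "V *\<^sub>v x \<in> carrier_vec n" using V x by simp
  ultimately show "x \<in> (*\<^sub>v) U ` carrier_vec n" by (rule image_eqI)
qed (use unimodular_carrier[OF assms] in auto)

lemma mult_mat_vec_nonzero:
  fixes A :: "'a :: idom mat"
  assumes "A \<in> carrier_mat n n" "det A \<noteq> 0" "x \<in> carrier_vec n" "x \<noteq> 0\<^sub>v n"
  shows "A *\<^sub>v x \<noteq> 0\<^sub>v n"
  using assms det_0_iff_vec_prod_zero by blast

lemma inj_on_mult_mat_vec:
  fixes A :: "'a :: idom mat"
  assumes A: "A \<in> carrier_mat n n" "det A \<noteq> 0" shows "inj_on ((*\<^sub>v) A) (carrier_vec n)"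
proof (rule inj_onI)
  fix x y :: "'a vec" assume xy: "x \<in> carrier_vec n" "y \<in> carrier_vec n" "A *\<^sub>v x = A *\<^sub>v y"
  have "A *\<^sub>v (x - y) = A *\<^sub>v x - A *\<^sub>v y"
    using A xy by (simp add: mult_minus_distrib_mat_vec[of _ n n])
  also have "\<dots> = 0\<^sub>v n" using A xy by simp
  finally have diff: "x - y = 0\<^sub>v n" using mult_mat_vec_nonzero[OF A, of "x - y"] xy by auto
  show "x = y"
  proof (rule eq_vecI)
    fix i assume i: "i < dim_vec y"
    then have "(x - y) $ i = 0" using xy by (simp only: diff) simp
    then show "x $ i = y $ i" using i by simp
  qed (use xy in auto)
qed

lemma det_congruent:
  assumes "G \<in> carrier_mat n n" "unimodular n U"
  shows "det (transpose_mat U * G * U) = det G"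
proof -
  have "det (transpose_mat U * G * U) = det U * det G * det U"
    using assms(1) unimodular_carrier[OF assms(2)]
    by (simp add: det_mult[of _ n] det_transpose[of _ n])
  also have "\<dots> = det G" using assms by (auto simp: unimodular_def abs_if split: if_splits)
  finally show ?thesis .
qed

lemma pos_def_congruent:
  fixes G :: "'a :: linordered_idom mat"
  assumes G: "pos_def n G" and U: "U \<in> carrier_mat n n" "det U \<noteq> 0"
  shows "pos_def n (transpose_mat U * G * U)"
  unfolding pos_def_def
proof (intro conjI ballI impI)
  show "transpose_mat (transpose_mat U * G * U) = transpose_mat U * G * U"
    using pos_def_carrier[OF G] pos_def_transpose[OF G] U(1)
    by (simp add: transpose_mult[of _ n n _ n] assoc_mult_mat[of _ n n _ n _ n])
next
  fix x :: "'a vec" assume x: "x \<in> carrier_vec n" "x \<noteq> 0\<^sub>v n"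
  then have "0 < quad G (U *\<^sub>v x)"
    using U by (intro pos_def_quad_pos[OF G] mult_mat_vec_nonzero) auto
  then show "0 < quad (transpose_mat U * G * U) x"
    using pos_def_carrier[OF G] U x by (subst quad_congruent) auto
qed (use pos_def_carrier[OF G] U in auto)

definition bordered :: "'a \<Rightarrow> 'a vec \<Rightarrow> 'a vec \<Rightarrow> 'a mat \<Rightarrow> 'a mat" where
  "bordered a r c D = mat (Suc (dim_vec c)) (Suc (dim_vec r))
     (\<lambda>(i, j). case i of 0 \<Rightarrow> vCons a r $ j | Suc k \<Rightarrow> vCons (c $ k) (row D k) $ j)"

lemma bordered_carrier [simp]:
  "r \<in> carrier_vec n \<Longrightarrow> c \<in> carrier_vec n \<Longrightarrow> bordered a r c D \<in> carrier_mat (Suc n) (Suc n)"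
  by (auto simp: bordered_def)

lemma bordered_mult_vCons:
  assumes "r \<in> carrier_vec n" "c \<in> carrier_vec n" "D \<in> carrier_mat n n" "y \<in> carrier_vec n"
  shows "bordered a r c D *\<^sub>v vCons t y
      = vCons (a * t + r \<bullet> y) (t \<cdot>\<^sub>v c + D *\<^sub>v (y :: 'a :: comm_ring_1 vec))"
proof (rule eq_vecI)
  fix i assume "i < dim_vec (vCons (a * t + r \<bullet> y) (t \<cdot>\<^sub>v c + D *\<^sub>v y))"
  then have i: "i < Suc n" using assms by auto
  have "row (bordered a r c D) i = (case i of 0 \<Rightarrow> vCons a r | Suc k \<Rightarrow> vCons (c $ k) (row D k))"
    using i assms by (intro eq_vecI) (auto simp: bordered_def split: nat.splits)
  with i show "(bordered a r c D *\<^sub>v vCons t y) $ i = vCons (a * t + r \<bullet> y) (t \<cdot>\<^sub>v c + D *\<^sub>v y) $ i"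
    using assms by (auto simp: bordered_def ac_simps split: nat.splits)
qed (use assms in \<open>auto simp: bordered_def\<close>)

lemma det_bordered_upper:
  fixes D :: "'a :: idom mat"
  assumes "r \<in> carrier_vec n" "D \<in> carrier_mat n n"
  shows "det (bordered a r (0\<^sub>v n) D) = a * det D"
proof -
  have "bordered a r (0\<^sub>v n) D
      = four_block_mat (mat 1 1 (\<lambda>_. a)) (mat 1 n (\<lambda>(i, j). r $ j)) (0\<^sub>m n 1) D"
    using assms
    by (intro eq_matI)
      (auto simp: bordered_def four_block_mat_def Let_def vec_index_vCons split: nat.splits)
  also have "det \<dots> = det (mat 1 1 (\<lambda>_. a)) * det D"
    using assms by (intro det_four_block_mat_lower_left_zero_col) auto
  also have "det (mat 1 1 (\<lambda>_. a)) = a" by (subst det_single) auto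
  finally show ?thesis .
qed

lemma transpose_bordered:
  assumes "r \<in> carrier_vec n" "c \<in> carrier_vec n" "D \<in> carrier_mat n n"
  shows "transpose_mat (bordered a r c D) = bordered a c r (transpose_mat D)"
  using assms by (intro eq_matI) (auto simp: bordered_def vec_index_vCons split: nat.splits)

lemma det_bordered_lower:
  fixes D :: "'a :: idom mat"
  assumes "c \<in> carrier_vec n" "D \<in> carrier_mat n n"
  shows "det (bordered a (0\<^sub>v n) c D) = a * det D"
proof -
  have "det (bordered a (0\<^sub>v n) c D) = det (transpose_mat (bordered a (0\<^sub>v n) c D))"
    using assms by (intro det_transpose[symmetric, of _ "Suc n"]) auto
  also have "\<dots> = a * det (transpose_mat D)"
    using assms by (simp add: transpose_bordered[of _ n] det_bordered_upper)
  finally show ?thesis using det_transpose[OF assms(2)] by simp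
qed

lemma symmetric_borderedE:
  fixes G :: "'a :: comm_ring_1 mat"
  assumes "G \<in> carrier_mat (Suc n) (Suc n)" "transpose_mat G = G"
  obtains m b C where "b \<in> carrier_vec n" "C \<in> carrier_mat n n" "transpose_mat C = C"
    "G = bordered m b b C"
proof
  let ?b = "vec n (\<lambda>i. G $$ (0, Suc i))" and ?C = "mat n n (\<lambda>(i, j). G $$ (Suc i, Suc j))"
  have sym: "G $$ (i, j) = G $$ (j, i)" if "i < Suc n" "j < Suc n" for i j
    using assms that by (metis carrier_matD index_transpose_mat(1))
  show "?b \<in> carrier_vec n" "?C \<in> carrier_mat n n" by auto
  show "transpose_mat ?C = ?C" by (intro eq_matI) (auto simp: sym)
  show "G = bordered (G $$ (0, 0)) ?b ?b ?C"
    using assms sym by (intro eq_matI) (auto simp: bordered_def vec_index_vCons split: nat.splits)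
qed

text \<open>This is \<open>m\<close> times the Schur complement, so that it stays integral.\<close>

definition schur :: "'a :: comm_ring_1 \<Rightarrow> 'a vec \<Rightarrow> 'a mat \<Rightarrow> 'a mat" where
  "schur m b C = mat (dim_vec b) (dim_vec b) (\<lambda>(i, j). m * C $$ (i, j) - b $ i * b $ j)"

lemma schur_carrier [simp]: "b \<in> carrier_vec n \<Longrightarrow> schur m b C \<in> carrier_mat n n"
  by (auto simp: schur_def)

lemma schur_symmetric:
  assumes "b \<in> carrier_vec n" "C \<in> carrier_mat n n" "transpose_mat C = C"
  shows "transpose_mat (schur m b C) = schur m b C"
proof -
  have "C $$ (i, j) = C $$ (j, i)" if "i < n" "j < n" for i j
    using assms that by (metis carrier_matD index_transpose_mat(1))
  then show ?thesis using assms by (intro eq_matI) (auto simp: schur_def)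
qed

lemma schur_mult_vec:
  assumes "b \<in> carrier_vec n" "C \<in> carrier_mat n n" "y \<in> carrier_vec n"
  shows "schur m b C *\<^sub>v y = m \<cdot>\<^sub>v (C *\<^sub>v y) - (b \<bullet> y) \<cdot>\<^sub>v b"
  using assms
  by (intro eq_vecI)
    (auto simp: schur_def scalar_prod_def sum_distrib_left sum_distrib_right sum_subtractf
      algebra_simps)

lemma quad_bordered:
  assumes "b \<in> carrier_vec n" "C \<in> carrier_mat n n" "y \<in> carrier_vec n"
  shows "m * quad (bordered m b b C) (vCons t y) = (m * t + b \<bullet> y)\<^sup>2 + quad (schur m b C) y"
proof -
  have expand: "quad (bordered m b b C) (vCons t y)
      = t * (m * t + b \<bullet> y) + (t * (b \<bullet> y) + y \<bullet> (C *\<^sub>v y))"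
    using assms comm_scalar_prod[of y n b]
    by (simp add: quad_def bordered_mult_vCons[of _ n] scalar_prod_add_distrib[of _ n])
  have expand_schur: "quad (schur m b C) y = m * (y \<bullet> (C *\<^sub>v y)) - (b \<bullet> y)\<^sup>2"
    using assms comm_scalar_prod[of y n b]
    by (simp add: quad_def schur_mult_vec[of _ n] scalar_prod_minus_distrib[of _ n]
        power2_eq_square)
  show ?thesis unfolding expand expand_schur by (simp add: power2_eq_square algebra_simps)
qed

lemma det_schur:
  fixes C :: "'a :: idom mat"
  assumes b: "b \<in> carrier_vec n" and C: "C \<in> carrier_mat n n"
  shows "m ^ n * det (bordered m b b C) = m * det (schur m b C)"
proof -
  let ?L = "bordered 1 (0\<^sub>v n) (- b) (m \<cdot>\<^sub>m 1\<^sub>m n)"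
  have L: "?L \<in> carrier_mat (Suc n) (Suc n)" and G: "bordered m b b C \<in> carrier_mat (Suc n) (Suc n)"
    using assms by auto
  have row: "row ?L i
      = (case i of 0 \<Rightarrow> vCons 1 (0\<^sub>v n) | Suc k \<Rightarrow> vCons (- b $ k) (m \<cdot>\<^sub>v unit_vec n k))"
    if "i < Suc n" for i
    using that b by (intro eq_vecI) (auto simp: bordered_def vec_index_vCons split: nat.splits)
  have col: "col (bordered m b b C) j = (case j of 0 \<Rightarrow> vCons m b | Suc k \<Rightarrow> vCons (b $ k) (col C k))"
    if "j < Suc n" for j
    using that b C by (intro eq_vecI) (auto simp: bordered_def vec_index_vCons split: nat.splits)
  have "?L * bordered m b b C = bordered m b (0\<^sub>v n) (schur m b C)"
  proof (rule eq_matI)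
    fix i j assume "i < dim_row (bordered m b (0\<^sub>v n) (schur m b C))"
      "j < dim_col (bordered m b (0\<^sub>v n) (schur m b C))"
    then have ij: "i < Suc n" "j < Suc n" using b by (auto simp: bordered_def)
    then have "(?L * bordered m b b C) $$ (i, j) = row ?L i \<bullet> col (bordered m b b C) j"
      using L G by (intro index_mult_mat) auto
    also have "\<dots> = bordered m b (0\<^sub>v n) (schur m b C) $$ (i, j)"
      unfolding row[OF ij(1)] col[OF ij(2)] using ij b C
      by (auto simp: bordered_def schur_def vec_index_vCons split: nat.splits)
    finally show "(?L * bordered m b b C) $$ (i, j)
        = bordered m b (0\<^sub>v n) (schur m b C) $$ (i, j)" .
  qed (use b in \<open>auto simp: bordered_def\<close>)
  then have "det ?L * det (bordered m b b C) = det (bordered m b (0\<^sub>v n) (schur m b C))"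
    using det_mult[OF L G] by simp
  moreover have "det ?L = m ^ n"
    using b by (subst det_bordered_lower) (auto simp: det_smult)
  moreover have "det (bordered m b (0\<^sub>v n) (schur m b C)) = m * det (schur m b C)"
    using b by (intro det_bordered_upper) auto
  ultimately show ?thesis by simp
qed

lemma unit_vec_Suc_0: "unit_vec (Suc n) 0 = vCons 1 (0\<^sub>v n)"
  by (intro eq_vecI) (auto simp: unit_vec_def vec_index_vCons)

lemma quad_bordered_unit_vec:
  assumes "b \<in> carrier_vec n" "C \<in> carrier_mat n n"
  shows "quad (bordered m b b C) (unit_vec (Suc n) 0) = m"
  using assms by (simp add: quad_def bordered_mult_vCons[of _ n] unit_vec_Suc_0 mult_mat_zero_vec)

lemma pos_def_bordered_pos:
  assumes "pos_def (Suc n) (bordered m b b C)" "b \<in> carrier_vec n" "C \<in> carrier_mat n n"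
  shows "0 < m"
  using pos_def_quad_pos[OF assms(1), of "unit_vec (Suc n) 0"] assms(2,3)
  by (simp add: quad_bordered_unit_vec)

lemma pos_def_schur:
  fixes C :: "'a :: linordered_idom mat"
  assumes G: "pos_def (Suc n) (bordered m b b C)"
    and b: "b \<in> carrier_vec n" and C: "C \<in> carrier_mat n n" "transpose_mat C = C"
  shows "pos_def n (schur m b C)"
  unfolding pos_def_def
proof (intro conjI ballI impI)
  fix y :: "'a vec" assume y: "y \<in> carrier_vec n" "y \<noteq> 0\<^sub>v n"
  have m: "0 < m" using pos_def_bordered_pos[OF G b C(1)] .
  obtain i where i: "i < n" "y $ i \<noteq> 0" using y by (metis carrier_vecD eq_vecI index_zero_vec)
  have "m \<cdot>\<^sub>v y \<noteq> 0\<^sub>v n"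
  proof
    assume "m \<cdot>\<^sub>v y = 0\<^sub>v n"
    then have "(m \<cdot>\<^sub>v y) $ i = 0" using i by simp
    then show False using i m y by simp
  qed
  then have "0 < quad (bordered m b b C) (vCons (- (b \<bullet> y)) (m \<cdot>\<^sub>v y))"
    using y by (intro pos_def_quad_pos[OF G]) (auto simp: zero_vec_Suc)
  then have "0 < m * quad (bordered m b b C) (vCons (- (b \<bullet> y)) (m \<cdot>\<^sub>v y))" using m by simp
  also have "\<dots> = m\<^sup>2 * quad (schur m b C) y"
    using b C y by (subst quad_bordered) (auto simp: quad_smult[of _ n])
  finally show "0 < quad (schur m b C) y" using m by (simp add: zero_less_mult_iff)
qed (use b C in \<open>auto intro: schur_symmetric\<close>)

lemma unimodular_bordered:
  "unimodular n W \<Longrightarrow> r \<in> carrier_vec n \<Longrightarrow> unimodular (Suc n) (bordered 1 r (0\<^sub>v n) W)"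
  by (auto simp: unimodular_def det_bordered_upper)

text \<open>Being the first column of a unimodular matrix; this makes a completion to a basis available
  without any gcd argument.\<close>

definition primitive :: "nat \<Rightarrow> int vec \<Rightarrow> bool" where
  "primitive n x \<longleftrightarrow> (\<exists>U. unimodular n U \<and> x = U *\<^sub>v unit_vec n 0)"

lemma primitive_carrier: "primitive n x \<Longrightarrow> x \<in> carrier_vec n"
  by (auto simp: primitive_def unimodular_def)

lemma primitive_unit_vec: "primitive n (unit_vec n 0)"
  using unimodular_one[of n] unfolding primitive_def by (intro exI[of _ "1\<^sub>m n"]) auto

lemma primitive_mult:
  assumes "unimodular n U" "primitive n x" shows "primitive n (U *\<^sub>v x)"
proof -
  obtain V where V: "unimodular n V" "x = V *\<^sub>v unit_vec n 0"
    using assms by (auto simp: primitive_def)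
  then have "U *\<^sub>v x = (U * V) *\<^sub>v unit_vec n 0"
    using assms by (auto simp: unimodular_def assoc_mult_mat_vec[of _ n n _ n])
  then show ?thesis using unimodular_mult[OF assms(1) V(1)] by (auto simp: primitive_def)
qed

lemma primitive_vCons:
  assumes "primitive n y" "0 < n" shows "primitive (Suc n) (vCons t y)"
proof -
  obtain V where V: "unimodular n V" "y = V *\<^sub>v unit_vec n 0"
    using assms by (auto simp: primitive_def)
  let ?P = "swaprows_mat (Suc n) 0 1 :: int mat"
  let ?U = "bordered 1 (t \<cdot>\<^sub>v unit_vec n 0) (0\<^sub>v n) V"
  have P: "unimodular (Suc n) ?P"
    using assms by (auto simp: unimodular_def det_swaprows_mat)
  have "primitive (Suc n) (?P *\<^sub>v unit_vec (Suc n) 0)"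
    by (rule primitive_mult[OF P primitive_unit_vec])
  also have "?P *\<^sub>v unit_vec (Suc n) 0 = vCons 0 (unit_vec n 0)"
    using assms by (intro eq_vecI) (auto simp: vec_index_vCons)
  finally have "primitive (Suc n) (?U *\<^sub>v vCons 0 (unit_vec n 0))"
    using V by (intro primitive_mult unimodular_bordered) auto
  moreover have "0 \<cdot>\<^sub>v 0\<^sub>v n = (0\<^sub>v n :: int vec)" by auto
  then have "?U *\<^sub>v vCons 0 (unit_vec n 0) = vCons t y"
    using V(2) unimodular_carrier[OF V(1)] assms(2) by (auto simp: bordered_mult_vCons[of _ n])
  ultimately show ?thesis by simp
qed

lemma pos_def_primitive_borderedE:
  assumes G: "pos_def (Suc n) G" and x: "primitive (Suc n) x"
  obtains U b C where "unimodular (Suc n) U"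
    "b \<in> carrier_vec n" "C \<in> carrier_mat n n" "transpose_mat C = C"
    "pos_def (Suc n) (bordered (quad G x) b b C)" "det (bordered (quad G x) b b C) = det G"
    "\<And>z. z \<in> carrier_vec (Suc n) \<Longrightarrow> quad G (U *\<^sub>v z) = quad (bordered (quad G x) b b C) z"
proof -
  obtain U where U: "unimodular (Suc n) U" "x = U *\<^sub>v unit_vec (Suc n) 0"
    using x by (auto simp: primitive_def)
  note carrier = pos_def_carrier[OF G] unimodular_carrier[OF U(1)]
  let ?G = "transpose_mat U * G * U"
  have pos_def: "pos_def (Suc n) ?G"
    using U by (intro pos_def_congruent[OF G]) (auto simp: unimodular_def)
  then obtain m b C where bC: "b \<in> carrier_vec n" "C \<in> carrier_mat n n" "transpose_mat C = C"
    and eq: "?G = bordered m b b C"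
    by (auto simp: pos_def_def elim: symmetric_borderedE)
  have quad: "quad G (U *\<^sub>v z) = quad ?G z" if "z \<in> carrier_vec (Suc n)" for z
    using quad_congruent[OF carrier that] ..
  have "quad G x = m"
    using quad[of "unit_vec (Suc n) 0"] quad_bordered_unit_vec[OF bC(1,2)] by (simp add: U eq)
  then show thesis
    using that[OF U(1) bC] pos_def det_congruent[OF carrier(1) U(1)] quad by (simp add: eq)
qed

lemma nearest_multiple:
  fixes m a :: int
  assumes "0 < m" obtains t where "4 * (m * t + a)\<^sup>2 \<le> m\<^sup>2"
proof
  let ?t = "- ((2 * a + m) div (2 * m))"
  have "(2 * a + m) mod (2 * m) = (2 * a + m) + 2 * m * ?t"
    by (simp add: minus_div_mult_eq_mod[symmetric] algebra_simps)
  moreover have "0 \<le> (2 * a + m) mod (2 * m)" "(2 * a + m) mod (2 * m) < 2 * m" using assms by auto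
  ultimately have "\<bar>2 * (m * ?t + a)\<bar> \<le> m" by (simp only: abs_le_iff) (simp add: algebra_simps)
  then have "(2 * (m * ?t + a))\<^sup>2 \<le> m\<^sup>2" using assms by (simp only: power2_le_iff_abs_le)
  then show "4 * (m * ?t + a)\<^sup>2 \<le> m\<^sup>2" by (simp only: power_mult_distrib) simp
qed

lemma hermite_bound_step:
  fixes m s d :: int
  assumes m: "0 < m" and step: "3 * m\<^sup>2 \<le> 4 * s"
    and bound: "3 ^ e * s ^ Suc n \<le> 4 ^ e * (m ^ n * d)"
  shows "3 ^ (e + Suc n) * m ^ Suc (Suc n) \<le> 4 ^ (e + Suc n) * d"
proof -
  have "m ^ n * (3 ^ (e + Suc n) * m ^ Suc (Suc n)) = 3 ^ e * (3 * m\<^sup>2) ^ Suc n"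
    by (simp add: power_add power_mult_distrib power_mult[symmetric] power2_eq_square)
  also have "\<dots> \<le> 3 ^ e * (4 * s) ^ Suc n"
    using step m by (intro mult_left_mono power_mono) auto
  also have "\<dots> = 4 ^ Suc n * (3 ^ e * s ^ Suc n)" by (simp add: power_mult_distrib)
  also have "\<dots> \<le> 4 ^ Suc n * (4 ^ e * (m ^ n * d))"
    using bound by (intro mult_left_mono) auto
  also have "\<dots> = m ^ n * (4 ^ (e + Suc n) * d)" by (simp add: power_add)
  finally show ?thesis using m by simp
qed

text \<open>If \<open>x\<close> is a shortest primitive vector, then \<open>y\<close>, a primitive vector that is short for the
  Schur complement, lifts to a primitive vector \<open>(t, y)\<close> whose component along \<open>x\<close> is at most half
  of \<open>x\<close>.\<close>

lemma hermite_bound: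
  assumes "pos_def (Suc n) G"
  shows "\<exists>x. primitive (Suc n) x \<and>
    3 ^ (Suc n choose 2) * quad G x ^ Suc n \<le> 4 ^ (Suc n choose 2) * det G"
  using assms
proof (induction n arbitrary: G)
  case 0
  then have "quad G (unit_vec 1 0) = det G"
    by (subst det_single) (auto simp: pos_def_def quad_def scalar_prod_def)
  then show ?case
    using primitive_unit_vec[of 1] by (intro exI[of _ "unit_vec 1 0"]) (auto simp: numeral_2_eq_2)
next
  case (Suc n)
  let ?N = "Suc (Suc n)"
  obtain x where x: "primitive ?N x" and min: "\<And>z. primitive ?N z \<Longrightarrow> nat (quad G x) \<le> nat (quad G z)"
    using primitive_unit_vec
      ex_has_least_nat[of "primitive ?N" "unit_vec ?N 0" "\<lambda>x. nat (quad G x)"]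
    by auto
  define m where "m = quad G x"
  obtain U b C where U: "unimodular ?N U"
    and bC: "b \<in> carrier_vec (Suc n)" "C \<in> carrier_mat (Suc n) (Suc n)" "transpose_mat C = C"
    and bordered: "pos_def ?N (bordered m b b C)" "det (bordered m b b C) = det G"
    and quad: "\<And>z. z \<in> carrier_vec ?N \<Longrightarrow> quad G (U *\<^sub>v z) = quad (bordered m b b C) z"
    unfolding m_def using pos_def_primitive_borderedE[OF Suc.prems x] by metis
  have m: "0 < m" using pos_def_bordered_pos[OF bordered(1) bC(1,2)] .
  obtain y where y: "primitive (Suc n) y"
    and bound: "3 ^ (Suc n choose 2) * quad (schur m b C) y ^ Suc n
      \<le> 4 ^ (Suc n choose 2) * det (schur m b C)"
    using Suc.IH[OF pos_def_schur[OF bordered(1) bC]] by blast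
  note y_carrier = primitive_carrier[OF y]
  obtain t where t: "4 * (m * t + b \<bullet> y)\<^sup>2 \<le> m\<^sup>2" using nearest_multiple[OF m] .
  have "m \<le> quad (bordered m b b C) (vCons t y)"
    using min[OF primitive_mult[OF U primitive_vCons[OF y zero_less_Suc, of t]]] m y_carrier
    by (simp add: quad m_def)
  then have "m * m \<le> m * quad (bordered m b b C) (vCons t y)" using m by simp
  also have "\<dots> = (m * t + b \<bullet> y)\<^sup>2 + quad (schur m b C) y"
    by (rule quad_bordered[OF bC(1,2) y_carrier])
  finally have "3 * m\<^sup>2 \<le> 4 * quad (schur m b C) y" using t by (simp add: power2_eq_square)
  moreover have "det (schur m b C) = m ^ n * det G"
    using det_schur[OF bC(1,2), of m] m bordered(2) by simp
  moreover have "?N choose 2 = (Suc n choose 2) + Suc n" by (simp add: numeral_2_eq_2)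
  ultimately have "3 ^ (?N choose 2) * m ^ ?N \<le> 4 ^ (?N choose 2) * det G"
    using hermite_bound_step[OF m] bound by (simp only:)
  then show ?case using x unfolding m_def by blast
qed

text \<open>Hermite's constant \<open>(4/3)\<^bsup>(n-1)/2\<^esup>\<close> is less than 2 exactly for \<open>n \<le> 5\<close>.\<close>

lemma unimodular_lattice_primitive_norm_1:
  assumes G: "pos_def (Suc n) G" "det G = 1" and n: "Suc n \<le> 5"
  obtains x where "primitive (Suc n) x" "quad G x = 1"
proof -
  obtain x where x: "primitive (Suc n) x"
    and bound: "3 ^ (Suc n choose 2) * quad G x ^ Suc n \<le> 4 ^ (Suc n choose 2)"
    using hermite_bound[OF G(1)] G(2) by auto
  obtain U b C where "b \<in> carrier_vec n" "C \<in> carrier_mat n n"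
    "pos_def (Suc n) (bordered (quad G x) b b C)"
    using pos_def_primitive_borderedE[OF G(1) x] by metis
  then have pos: "0 < quad G x" using pos_def_bordered_pos by blast
  have "\<not> 2 \<le> quad G x"
  proof
    assume "2 \<le> quad G x"
    then have "2 ^ Suc n \<le> quad G x ^ Suc n" by (intro power_mono) auto
    then have "3 ^ (Suc n choose 2) * 2 ^ Suc n \<le> 3 ^ (Suc n choose 2) * quad G x ^ Suc n"
      by (intro mult_left_mono) auto
    then have "3 ^ (Suc n choose 2) * 2 ^ Suc n \<le> (4 :: int) ^ (Suc n choose 2)"
      using bound by (rule order_trans)
    moreover have "n \<in> {0, 1, 2, 3, 4}" using n by auto
    ultimately show False by (auto simp: eval_nat_numeral)
  qed
  then have "quad G x = 1" using pos by simp
  with x show thesis by (rule that)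
qed

definition orthonormalizes :: "nat \<Rightarrow> int mat \<Rightarrow> int mat \<Rightarrow> bool" where
  "orthonormalizes n U G \<longleftrightarrow> unimodular n U \<and> (\<forall>x\<in>carrier_vec n. quad G (U *\<^sub>v x) = x \<bullet> x)"

lemma orthonormalizes_bordered:
  assumes b: "b \<in> carrier_vec n" and C: "C \<in> carrier_mat n n"
    and W: "orthonormalizes n W (schur 1 b C)"
  shows "orthonormalizes (Suc n) (bordered 1 (- (transpose_mat W *\<^sub>v b)) (0\<^sub>v n) W)
    (bordered 1 b b C)"
  unfolding orthonormalizes_def
proof (intro conjI ballI)
  let ?r = "- (transpose_mat W *\<^sub>v b)"
  have uni: "unimodular n W" using W by (simp add: orthonormalizes_def)
  have carrier: "W \<in> carrier_mat n n" "?r \<in> carrier_vec n"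
    using unimodular_carrier[OF uni] b by auto
  show "unimodular (Suc n) (bordered 1 ?r (0\<^sub>v n) W)"
    using uni carrier(2) by (rule unimodular_bordered)
  fix x :: "int vec" assume "x \<in> carrier_vec (Suc n)"
  then obtain t y where x: "x = vCons t y" and y: "y \<in> carrier_vec n" by (cases x) auto
  have "?r \<bullet> y = - ((transpose_mat W *\<^sub>v b) \<bullet> y)"
    using y carrier b by (intro scalar_prod_uminus_left) auto
  then have "?r \<bullet> y = - (b \<bullet> (W *\<^sub>v y))" using transpose_vec_mult_scalar[OF carrier(1) y b] by simp
  moreover have "t \<cdot>\<^sub>v 0\<^sub>v n = (0\<^sub>v n :: int vec)" by auto
  ultimately have "bordered 1 ?r (0\<^sub>v n) W *\<^sub>v x = vCons (t - b \<bullet> (W *\<^sub>v y)) (W *\<^sub>v y)"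
    using carrier y by (simp add: x bordered_mult_vCons[of _ n])
  then show "quad (bordered 1 b b C) (bordered 1 ?r (0\<^sub>v n) W *\<^sub>v x) = x \<bullet> x"
    using quad_bordered[OF b C, of "W *\<^sub>v y" 1 "t - b \<bullet> (W *\<^sub>v y)"] W carrier y
    by (simp add: orthonormalizes_def x power2_eq_square)
qed

theorem unimodular_lattice_orthonormal_basis:
  assumes "pos_def n G" "det G = 1" "n \<le> 5"
  shows "\<exists>U. orthonormalizes n U G"
  using assms
proof (induction n arbitrary: G)
  case 0
  have "quad G (1\<^sub>m 0 *\<^sub>v x) = x \<bullet> x" if "x \<in> carrier_vec 0" for x
    using that by (auto simp: quad_def scalar_prod_def)
  then show ?case using unimodular_one unfolding orthonormalizes_def by blast
next
  case (Suc n)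
  obtain x where x: "primitive (Suc n) x" "quad G x = 1"
    using unimodular_lattice_primitive_norm_1[OF Suc.prems] .
  obtain U b C where U: "unimodular (Suc n) U"
    and bC: "b \<in> carrier_vec n" "C \<in> carrier_mat n n" "transpose_mat C = C"
    and bordered: "pos_def (Suc n) (bordered 1 b b C)" "det (bordered 1 b b C) = det G"
    and quad: "\<And>z. z \<in> carrier_vec (Suc n) \<Longrightarrow> quad G (U *\<^sub>v z) = quad (bordered 1 b b C) z"
    using pos_def_primitive_borderedE[OF Suc.prems(1) x(1)] x(2) by metis
  have "det (schur 1 b C) = 1" using det_schur[OF bC(1,2), of 1] bordered(2) Suc.prems(2) by simp
  then obtain W where "orthonormalizes n W (schur 1 b C)"
    using Suc.IH[OF pos_def_schur[OF bordered(1) bC]] Suc.prems(3) by auto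
  from orthonormalizes_bordered[OF bC(1,2) this]
  obtain V where V: "orthonormalizes (Suc n) V (bordered 1 b b C)" by blast
  then have "V \<in> carrier_mat (Suc n) (Suc n)" by (simp add: orthonormalizes_def unimodular_def)
  then have "orthonormalizes (Suc n) (U * V) G"
    using V U unimodular_carrier[OF U]
    unfolding orthonormalizes_def by (auto simp: quad unimodular_mult)
  then show ?case ..
qed

section \<open>Sums of squares\<close>

lemma vecs_over_eq_image_lists:
  "{v \<in> carrier_vec n. set\<^sub>v v \<subseteq> A} = vec_of_list ` {xs. set xs \<subseteq> A \<and> length xs = n}"
proof (intro equalityI subsetI)
  fix v assume "v \<in> {v \<in> carrier_vec n. set\<^sub>v v \<subseteq> A}"
  then have "list_of_vec v \<in> {xs. set xs \<subseteq> A \<and> length xs = n}"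
    unfolding mem_Collect_eq set_list_of_vec by simp
  then show "v \<in> vec_of_list ` {xs. set xs \<subseteq> A \<and> length xs = n}"
    by (rule image_eqI[rotated]) (simp add: vec_list)
next
  fix v assume "v \<in> vec_of_list ` {xs. set xs \<subseteq> A \<and> length xs = n}"
  then obtain xs where xs: "v = vec_of_list xs" "set xs \<subseteq> A" "length xs = n" by blast
  have "set\<^sub>v v = set xs" unfolding xs(1) by (metis list_vec set_list_of_vec)
  then show "v \<in> {v \<in> carrier_vec n. set\<^sub>v v \<subseteq> A}"
    using xs by (auto intro: carrier_vecI)
qed

lemma finite_vecs_over: "finite A \<Longrightarrow> finite {v \<in> carrier_vec n. set\<^sub>v v \<subseteq> A}"
  by (simp add: vecs_over_eq_image_lists finite_lists_length_eq)

lemma card_vecs_over: "finite A \<Longrightarrow> card {v \<in> carrier_vec n. set\<^sub>v v \<subseteq> A} = card A ^ n"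
  unfolding vecs_over_eq_image_lists
  by (subst card_image[OF inj_on_inverseI[of _ list_of_vec]])
    (simp_all add: list_vec card_lists_length_eq)

definition reps :: "nat \<Rightarrow> int \<Rightarrow> int vec set" where
  "reps n k = {x \<in> carrier_vec n. x \<bullet> x = k}"

lemma finite_reps: "finite (reps n k)"
proof (rule finite_subset)
  show "reps n k \<subseteq> {x \<in> carrier_vec n. set\<^sub>v x \<subseteq> {- k..k}}"
  proof
    fix x assume x: "x \<in> reps n k"
    have "\<bar>x $ i\<bar> \<le> k" if "i < n" for i
    proof -
      have "\<bar>x $ i\<bar> \<le> x $ i * x $ i"
        using abs_le_power2 by (simp add: power2_eq_square)
      also have "\<dots> \<le> x \<bullet> x"
        unfolding scalar_prod_def using that x by (intro member_le_sum) (auto simp: reps_def)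
      finally show ?thesis using x by (simp add: reps_def)
    qed
    then show "x \<in> {x \<in> carrier_vec n. set\<^sub>v x \<subseteq> {- k..k}}"
      using x by (force simp: reps_def vec_set_def abs_le_iff)
  qed
qed (simp add: finite_vecs_over)

lemma scaled_unimodular_sublattice_isometry:
  fixes K :: "int mat" and d :: int
  assumes K: "K \<in> carrier_mat n n" and d: "0 < d" and det: "(det K)\<^sup>2 = d ^ n" and n: "n \<le> 5"
    and dvd: "\<And>x y. x \<in> carrier_vec n \<Longrightarrow> y \<in> carrier_vec n \<Longrightarrow> d dvd (K *\<^sub>v x) \<bullet> (K *\<^sub>v y)"
  obtains U where "unimodular n U"
    "\<And>x. x \<in> carrier_vec n \<Longrightarrow> (K *\<^sub>v (U *\<^sub>v x)) \<bullet> (K *\<^sub>v (U *\<^sub>v x)) = d * (x \<bullet> x)"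
proof -
  define G where "G = mat n n (\<lambda>(i, j). (col K i \<bullet> col K j) div d)"
  have G: "G \<in> carrier_mat n n" by (simp add: G_def)
  have "K *\<^sub>v unit_vec n i = col K i" if "i < n" for i
    using K that by (intro eq_vecI) auto
  then have "d dvd col K i \<bullet> col K j" if "i < n" "j < n" for i j
    using dvd[of "unit_vec n i" "unit_vec n j"] that by simp
  then have gram: "transpose_mat K * K = d \<cdot>\<^sub>m G"
    using K by (intro eq_matI) (auto simp: G_def)
  have quad: "d * quad G x = (K *\<^sub>v x) \<bullet> (K *\<^sub>v x)" if x: "x \<in> carrier_vec n" for x
  proof -
    have "(K *\<^sub>v x) \<bullet> (K *\<^sub>v x) = x \<bullet> ((transpose_mat K * K) *\<^sub>v x)"
      using K x by (simp add: scalar_prod_mult_mat_vec[of _ n n] assoc_mult_mat_vec[of _ n n _ n])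
    also have "(transpose_mat K * K) *\<^sub>v x = d \<cdot>\<^sub>v (G *\<^sub>v x)"
      unfolding gram using G x by (intro eq_vecI) auto
    finally show ?thesis using G x by (simp add: quad_def)
  qed
  have "det K \<noteq> 0" using det d by auto
  then have "0 < d * quad G x" if "x \<in> carrier_vec n" "x \<noteq> 0\<^sub>v n" for x
    unfolding quad[OF that(1)]
    using K that by (intro scalar_prod_self_int_pos mult_mat_vec_nonzero) auto
  moreover have "transpose_mat G = G"
    using K by (intro eq_matI)
      (auto simp: G_def intro!: arg_cong[of _ _ "\<lambda>a. a div d"] comm_scalar_prod[of _ n])
  ultimately have "pos_def n G" using G d by (auto simp: pos_def_def zero_less_mult_iff)
  moreover have "d ^ n * det G = d ^ n"
    using arg_cong[OF gram, of det] K G det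
    by (simp add: det_mult[of _ n] det_transpose[of _ n] det_smult power2_eq_square)
  then have "det G = 1" using d by simp
  ultimately obtain U where U: "orthonormalizes n U G"
    using unimodular_lattice_orthonormal_basis n by blast
  then have carrier: "U \<in> carrier_mat n n" by (simp add: orthonormalizes_def unimodular_def)
  show thesis
  proof (rule that)
    show "unimodular n U" using U by (simp add: orthonormalizes_def)
    show "(K *\<^sub>v (U *\<^sub>v x)) \<bullet> (K *\<^sub>v (U *\<^sub>v x)) = d * (x \<bullet> x)" if "x \<in> carrier_vec n" for x
      using U carrier that quad[of "U *\<^sub>v x"] by (simp add: orthonormalizes_def)
  qed
qed

lemma card_scaled_unimodular_sublattice:
  fixes K :: "int mat" and d :: int
  assumes K: "K \<in> carrier_mat n n" and d: "0 < d" and det: "(det K)\<^sup>2 = d ^ n" and n: "n \<le> 5"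
    and dvd: "\<And>x y. x \<in> carrier_vec n \<Longrightarrow> y \<in> carrier_vec n \<Longrightarrow> d dvd (K *\<^sub>v x) \<bullet> (K *\<^sub>v y)"
  shows "card {y \<in> (*\<^sub>v) K ` carrier_vec n. y \<bullet> y = d * k} = card (reps n k)"
proof -
  obtain U where U: "unimodular n U"
    and norm: "\<And>x. x \<in> carrier_vec n \<Longrightarrow> (K *\<^sub>v (U *\<^sub>v x)) \<bullet> (K *\<^sub>v (U *\<^sub>v x)) = d * (x \<bullet> x)"
    using scaled_unimodular_sublattice_isometry[OF assms] by blast
  have "(*\<^sub>v) K ` carrier_vec n = (\<lambda>x. K *\<^sub>v (U *\<^sub>v x)) ` carrier_vec n"
    unfolding image_image[symmetric] image_unimodular[OF U] ..
  then have "{y \<in> (*\<^sub>v) K ` carrier_vec n. y \<bullet> y = d * k} = (\<lambda>x. K *\<^sub>v (U *\<^sub>v x)) ` reps n k"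
    using norm d by (auto simp: reps_def)
  moreover have "inj_on (\<lambda>x. K *\<^sub>v (U *\<^sub>v x)) (reps n k)"
  proof -
    have "inj_on ((*\<^sub>v) K) (carrier_vec n)" "inj_on ((*\<^sub>v) U) (carrier_vec n)"
      using K det d U by (auto intro!: inj_on_mult_mat_vec simp: unimodular_def)
    moreover have "(*\<^sub>v) U ` reps n k \<subseteq> carrier_vec n"
      using unimodular_carrier[OF U] by (auto simp: reps_def)
    moreover have "reps n k \<subseteq> carrier_vec n" by (auto simp: reps_def)
    ultimately show ?thesis unfolding inj_on_def by blast
  qed
  ultimately show ?thesis by (simp add: card_image)
qed

section \<open>Congruences of integer vectors\<close>

definition vec_cong :: "int \<Rightarrow> int vec \<Rightarrow> int vec \<Rightarrow> bool" where
  "vec_cong m u v \<longleftrightarrow> dim_vec u = dim_vec v \<and> (\<forall>i<dim_vec v. [u $ i = v $ i] (mod m))"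

lemma vec_cong_refl [simp]: "vec_cong m v v"
  by (simp add: vec_cong_def)

lemma vec_cong_sym: "vec_cong m u v \<Longrightarrow> vec_cong m v u"
  by (simp add: vec_cong_def cong_def)

lemma vec_cong_trans [trans]: "vec_cong m u v \<Longrightarrow> vec_cong m v w \<Longrightarrow> vec_cong m u w"
  by (simp add: vec_cong_def cong_def)

lemma vec_cong_carrier: "vec_cong m u v \<Longrightarrow> v \<in> carrier_vec n \<Longrightarrow> u \<in> carrier_vec n"
  unfolding vec_cong_def by (metis carrier_vecD carrier_vecI)

lemma vec_cong_nth: "vec_cong m u v \<Longrightarrow> v \<in> carrier_vec n \<Longrightarrow> i < n \<Longrightarrow> [u $ i = v $ i] (mod m)"
  unfolding vec_cong_def by (metis carrier_vecD)

lemma vec_cong_add: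
  "vec_cong m u u' \<Longrightarrow> vec_cong m v v' \<Longrightarrow> dim_vec u' = dim_vec v' \<Longrightarrow> vec_cong m (u + v) (u' + v')"
  by (simp add: vec_cong_def cong_add)

lemma vec_cong_smult: "[a = b] (mod m) \<Longrightarrow> vec_cong m u v \<Longrightarrow> vec_cong m (a \<cdot>\<^sub>v u) (b \<cdot>\<^sub>v v)"
  by (simp add: vec_cong_def cong_mult)

lemma vec_cong_scalar_prod:
  assumes "vec_cong m u u'" "vec_cong m v v'" "u' \<in> carrier_vec n" "v' \<in> carrier_vec n"
  shows "[u \<bullet> v = u' \<bullet> v'] (mod m)"
  using assms unfolding vec_cong_def scalar_prod_def by (auto intro!: cong_sum cong_mult)

lemma vec_cong_zero_iff: "vec_cong m v (0\<^sub>v n) \<longleftrightarrow> dim_vec v = n \<and> (\<forall>i<n. m dvd v $ i)"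
  by (auto simp: vec_cong_def cong_0_iff)

lemma vec_cong_smult_zero_iff:
  assumes "prime p" "v \<in> carrier_vec n"
  shows "vec_cong p (a \<cdot>\<^sub>v v) (0\<^sub>v n) \<longleftrightarrow> p dvd a \<or> vec_cong p v (0\<^sub>v n)"
  using assms by (auto simp: vec_cong_zero_iff prime_dvd_mult_iff)

lemma vec_cong_smult_swap:
  assumes "[a * c = 1] (mod m)" "vec_cong m u (a \<cdot>\<^sub>v v)" shows "vec_cong m v (c \<cdot>\<^sub>v u)"
proof -
  have "vec_cong m (c \<cdot>\<^sub>v u) ((a * c) \<cdot>\<^sub>v v)"
    using vec_cong_smult[OF cong_refl assms(2), of c] by (simp add: smult_smult_assoc mult.commute)
  also have "vec_cong m \<dots> (1 \<cdot>\<^sub>v v)" using assms(1) by (rule vec_cong_smult) simp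
  finally have "vec_cong m (c \<cdot>\<^sub>v u) v" by simp
  then show ?thesis by (rule vec_cong_sym)
qed

lemma vec_congE:
  assumes "vec_cong m u v" "v \<in> carrier_vec n"
  obtains w where "w \<in> carrier_vec n" "u = v + m \<cdot>\<^sub>v w"
proof
  show "vec n (\<lambda>i. (u $ i - v $ i) div m) \<in> carrier_vec n" by simp
  show "u = v + m \<cdot>\<^sub>v vec n (\<lambda>i. (u $ i - v $ i) div m)"
    using assms by (intro eq_vecI) (auto simp: vec_cong_def cong_iff_dvd_diff)
qed

lemma scalar_prod_add_self:
  fixes u v :: "'a :: comm_ring_1 vec"
  assumes "u \<in> carrier_vec n" "v \<in> carrier_vec n"
  shows "(u + v) \<bullet> (u + v) = u \<bullet> u + 2 * (u \<bullet> v) + v \<bullet> v"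
  using assms comm_scalar_prod[of v n u]
  by (simp add: scalar_prod_add_distrib[of _ n] add_scalar_prod_distrib[of _ n])

lemma prime_inverse_cong:
  fixes p c :: int
  assumes "prime p" "\<not> p dvd c" obtains b where "[c * b = 1] (mod p)" "\<not> p dvd b"
proof -
  have "coprime c p" using assms prime_imp_coprime coprime_commute by blast
  then obtain b where b: "[c * b = 1] (mod p)" using cong_solve_coprime_int by blast
  moreover have "\<not> p dvd b"
  proof
    assume "p dvd b"
    then have "p dvd c * b" by simp
    then have "p dvd 1" using cong_dvd_iff[OF b] by simp
    then show False using assms(1) by (simp add: not_prime_unit)
  qed
  ultimately show thesis by (rule that)
qed

definition residue_vecs :: "nat \<Rightarrow> int \<Rightarrow> int vec set" where
  "residue_vecs n p = {v \<in> carrier_vec n. set\<^sub>v v \<subseteq> {0..<p}}"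

definition reduce :: "int \<Rightarrow> int vec \<Rightarrow> int vec" where
  "reduce p v = map_vec (\<lambda>a. a mod p) v"

lemma residue_vecs_carrier: "v \<in> residue_vecs n p \<Longrightarrow> v \<in> carrier_vec n"
  by (simp add: residue_vecs_def)

lemma finite_residue_vecs: "finite (residue_vecs n p)"
  by (simp add: residue_vecs_def finite_vecs_over)

lemma card_residue_vecs: "0 < p \<Longrightarrow> int (card (residue_vecs n p)) = p ^ n"
  by (simp add: residue_vecs_def card_vecs_over)

lemma reduce_residue_vecs: "0 < p \<Longrightarrow> v \<in> carrier_vec n \<Longrightarrow> reduce p v \<in> residue_vecs n p"
  by (auto simp: reduce_def residue_vecs_def)

lemma vec_cong_reduce: "vec_cong p (reduce p v) v"
  by (simp add: reduce_def vec_cong_def cong_def)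

lemma residue_vecs_eqI:
  assumes u: "u \<in> residue_vecs n p" and v: "v \<in> residue_vecs n p" and "vec_cong p u v"
  shows "u = v"
proof (rule eq_vecI)
  have carrier: "u \<in> carrier_vec n" "v \<in> carrier_vec n"
    using u v by (simp_all add: residue_vecs_def)
  then show "dim_vec u = dim_vec v" by simp
  fix i assume "i < dim_vec v"
  then have i: "i < n" using carrier by simp
  then have "u $ i \<in> {0..<p}" "v $ i \<in> {0..<p}"
    using u v carrier by (auto simp: residue_vecs_def vec_set_def)
  then show "u $ i = v $ i" using vec_cong_nth[OF assms(3) carrier(2) i] by (simp add: cong_def)
qed

lemma card_linear_cong:
  fixes p a e :: int
  assumes "prime p" "\<not> p dvd e" shows "card {t \<in> {0..<p}. p dvd a + t * e} = 1"
proof -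
  have p0: "0 < p" using assms(1) by (rule prime_gt_0_int)
  obtain b where b: "[e * b = 1] (mod p)" using prime_inverse_cong[OF assms] .
  have "{t \<in> {0..<p}. p dvd a + t * e} = {(- a * b) mod p}"
  proof (intro equalityI subsetI)
    fix t assume t: "t \<in> {t \<in> {0..<p}. p dvd a + t * e}"
    have "[t * 1 = t * (e * b)] (mod p)" by (intro cong_scalar_left cong_sym[OF b])
    also have "[t * (e * b) = - a * b] (mod p)"
      using t dvd_mult2[of p "a + t * e" b] by (simp add: cong_iff_dvd_diff algebra_simps)
    finally show "t \<in> {(- a * b) mod p}" using t by (simp add: cong_def)
  next
    fix t assume "t \<in> {(- a * b) mod p}"
    then have t: "t = (- a * b) mod p" by simp
    then have "[a + t * e = a + - a * b * e] (mod p)" by (intro cong_add cong_mult cong_refl) simp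
    also have "a + - a * b * e = a - a * (e * b)" by simp
    also have "[a - a * (e * b) = a - a * 1] (mod p)"
      by (intro cong_diff cong_scalar_left b cong_refl)
    finally have "p dvd a + t * e" by (simp add: cong_0_iff)
    then show "t \<in> {t \<in> {0..<p}. p dvd a + t * e}" using p0 by (simp add: t)
  qed
  then show ?thesis by simp
qed

lemma vec_cong_reduce_translate:
  assumes "v \<in> carrier_vec n" "d \<in> carrier_vec n"
  shows "vec_cong p (reduce p (v + a \<cdot>\<^sub>v d) + (- a) \<cdot>\<^sub>v d) v"
proof -
  have "vec_cong p (reduce p (v + a \<cdot>\<^sub>v d) + (- a) \<cdot>\<^sub>v d) (v + a \<cdot>\<^sub>v d + (- a) \<cdot>\<^sub>v d)"
    using assms by (intro vec_cong_add vec_cong_reduce vec_cong_refl) simp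
  also have "v + a \<cdot>\<^sub>v d + (- a) \<cdot>\<^sub>v d = v" using assms by (intro eq_vecI) auto
  finally show ?thesis .
qed

lemma reduce_reduce_translate:
  assumes "0 < p" "v \<in> residue_vecs n p" "d \<in> carrier_vec n"
  shows "reduce p (reduce p (v + a \<cdot>\<^sub>v d) + (- a) \<cdot>\<^sub>v d) = v"
proof (rule residue_vecs_eqI[OF _ assms(2)])
  note v = residue_vecs_carrier[OF assms(2)]
  have "v + a \<cdot>\<^sub>v d \<in> carrier_vec n" using v assms(3) by simp
  then have "reduce p (v + a \<cdot>\<^sub>v d) \<in> carrier_vec n" by (rule vec_cong_carrier[OF vec_cong_reduce])
  then show "reduce p (reduce p (v + a \<cdot>\<^sub>v d) + (- a) \<cdot>\<^sub>v d) \<in> residue_vecs n p"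
    using assms by (intro reduce_residue_vecs) auto
  show "vec_cong p (reduce p (reduce p (v + a \<cdot>\<^sub>v d) + (- a) \<cdot>\<^sub>v d)) v"
    using vec_cong_reduce vec_cong_reduce_translate[OF v assms(3)] by (rule vec_cong_trans)
qed

lemma card_residue_vecs_translate:
  fixes p :: int
  assumes p: "0 < p" and d: "d \<in> carrier_vec n"
    and affine: "\<And>u v t. v \<in> carrier_vec n \<Longrightarrow> P v \<Longrightarrow> vec_cong p u (v + t \<cdot>\<^sub>v d) \<Longrightarrow>
      P u \<and> [g u = g v + t * e v] (mod p)"
  shows "card {v \<in> residue_vecs n p. P v \<and> p dvd g v + t * e v} =
    card {v \<in> residue_vecs n p. P v \<and> p dvd g v}"
    (is "card ?Z' = card ?Z")
proof (rule bij_betw_same_card)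
  let ?f = "\<lambda>a v. reduce p (v + a \<cdot>\<^sub>v d)"
  note carrier = residue_vecs_carrier[of _ n p]
  have mem: "?f a v \<in> residue_vecs n p" if "v \<in> residue_vecs n p" for a v
    using p d carrier[OF that] by (intro reduce_residue_vecs) auto
  have inverse: "?f (- a) (?f a v) = v" if "v \<in> residue_vecs n p" for a v
    by (rule reduce_reduce_translate[OF p that d])
  have shift: "P (?f a v)" "[g (?f a v) = g v + a * e v] (mod p)"
    if "v \<in> residue_vecs n p" "P v" for a v
    using affine[OF carrier[OF that(1)] that(2) vec_cong_reduce] by blast+
  show "bij_betw (?f t) ?Z' ?Z"
  proof (rule bij_betw_byWitness[where f' = "?f (- t)"])
    show "\<forall>v\<in>?Z'. ?f (- t) (?f t v) = v"
      by (intro ballI inverse) simp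
    show "\<forall>u\<in>?Z. ?f t (?f (- t) u) = u"
      using inverse[of _ "- t", unfolded minus_minus] by (intro ballI) simp
    show "?f t ` ?Z' \<subseteq> ?Z"
    proof (rule image_subsetI)
      fix v assume "v \<in> ?Z'"
      then have v: "v \<in> residue_vecs n p" "P v" "p dvd g v + t * e v" by auto
      then show "?f t v \<in> ?Z"
        using mem[OF v(1)] shift(1)[OF v(1,2)] cong_dvd_iff[OF shift(2)[OF v(1,2), of t]] by simp
    qed
    show "?f (- t) ` ?Z \<subseteq> ?Z'"
    proof (rule image_subsetI)
      fix u assume "u \<in> ?Z"
      then have u: "u \<in> residue_vecs n p" "P u" "p dvd g u" by auto
      let ?v = "?f (- t) u"
      have "vec_cong p (?v + t \<cdot>\<^sub>v d) u"
        using vec_cong_reduce_translate[OF carrier[OF u(1)] d, of p "- t"] unfolding minus_minus .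
      then have "[g u = g ?v + t * e ?v] (mod p)"
        using affine[OF carrier[OF mem[OF u(1)]] shift(1)[OF u(1,2)]] vec_cong_sym by blast
      then show "?v \<in> ?Z'"
        using mem[OF u(1)] shift(1)[OF u(1,2)] u(3) cong_dvd_iff by blast
    qed
  qed
qed

text \<open>Count the pairs \<open>(v, t)\<close> for which \<open>g\<close> vanishes at \<open>v + t d\<close> modulo \<open>p\<close>: for given \<open>v\<close> there
  is one such \<open>t\<close>, as \<open>g\<close> is affine with invertible slope \<open>e v\<close>, and for given \<open>t\<close> one can
  translate.\<close>

lemma card_residue_vecs_affine:
  fixes p :: int
  assumes p: "prime p" and d: "d \<in> carrier_vec n"
    and affine: "\<And>u v t. v \<in> carrier_vec n \<Longrightarrow> P v \<Longrightarrow> vec_cong p u (v + t \<cdot>\<^sub>v d) \<Longrightarrow>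
      P u \<and> [g u = g v + t * e v] (mod p)"
    and unit: "\<And>v. v \<in> carrier_vec n \<Longrightarrow> P v \<Longrightarrow> \<not> p dvd e v"
  shows "int (card {v \<in> residue_vecs n p. P v})
      = p * int (card {v \<in> residue_vecs n p. P v \<and> p dvd g v})"
proof -
  let ?S = "{v \<in> residue_vecs n p. P v}" and ?Z = "{v \<in> residue_vecs n p. P v \<and> p dvd g v}"
  have p0: "0 < p" using p by (rule prime_gt_0_int)
  have "{v \<in> ?S. p dvd g v + t * e v} = {v \<in> residue_vecs n p. P v \<and> p dvd g v + t * e v}" for t
    by blast
  then have translate: "card {v \<in> ?S. p dvd g v + t * e v} = card ?Z" for t
    using card_residue_vecs_translate[OF p0 d affine] by (simp only:)
  have "\<forall>v\<in>?S. card {t \<in> {0..<p}. p dvd g v + t * e v} = 1"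
    using card_linear_cong[OF p] unit residue_vecs_carrier[of _ n p] by simp
  then have "(\<Sum>t\<in>{0..<p}. card {v \<in> ?S. p dvd g v + t * e v}) = (\<Sum>v\<in>?S. 1)"
    by (intro sum_multicount_gen) (simp_all add: finite_residue_vecs)
  then have "nat p * card ?Z = card ?S"
    by (simp only: translate sum_constant card_atLeastLessThan_int diff_0_right of_nat_id
        mult_1_right)
  then have "int (nat p * card ?Z) = int (card ?S)" by (simp only:)
  then show ?thesis using p0 by (simp only: of_nat_mult int_nat_eq if_True less_imp_le)
qed

section \<open>Isotropic lines modulo a prime\<close>

definition isotropic :: "nat \<Rightarrow> int \<Rightarrow> int vec set" where
  "isotropic n p = {v \<in> residue_vecs n p. \<not> vec_cong p v (0\<^sub>v n) \<and> p dvd v \<bullet> v}"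

lemma finite_isotropic: "finite (isotropic n p)"
  by (rule finite_subset[OF _ finite_residue_vecs[of n p]]) (auto simp: isotropic_def)

lemma not_vec_cong_zeroE:
  assumes "\<not> vec_cong m v (0\<^sub>v n)" "v \<in> carrier_vec n"
  obtains i where "i < n" "\<not> m dvd v $ i"
  using assms by (auto simp: vec_cong_zero_iff)

lemma odd_prime_not_dvd_2:
  fixes p :: int
  assumes "prime p" "p \<noteq> 2" shows "\<not> p dvd 2"
  using assms primes_dvd_imp_eq[of p 2] by auto

lemma card_residue_vecs_orthogonal:
  fixes p :: int
  assumes p: "prime p" and x: "x \<in> carrier_vec n" "\<not> vec_cong p x (0\<^sub>v n)"
  shows "p ^ n = p * int (card {v \<in> residue_vecs n p. p dvd x \<bullet> v})"
proof -
  obtain j where j: "j < n" "\<not> p dvd x $ j" using x(2,1) by (rule not_vec_cong_zeroE)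
  have "int (card {v \<in> residue_vecs n p. True})
      = p * int (card {v \<in> residue_vecs n p. True \<and> p dvd x \<bullet> v})"
  proof (rule card_residue_vecs_affine[OF p, where d = "unit_vec n j" and e = "\<lambda>_. x $ j"])
    fix u v :: "int vec" and t
    assume v: "v \<in> carrier_vec n" and u: "vec_cong p u (v + t \<cdot>\<^sub>v unit_vec n j)"
    have "[x \<bullet> u = x \<bullet> (v + t \<cdot>\<^sub>v unit_vec n j)] (mod p)"
      using x(1) v by (intro vec_cong_scalar_prod[OF vec_cong_refl u]) auto
    then show "True \<and> [x \<bullet> u = x \<bullet> v + t * x $ j] (mod p)"
      using x v j by (simp add: scalar_prod_add_distrib[of _ n])
  qed (use j in auto)
  then show ?thesis using prime_gt_0_int[OF p] by (simp add: card_residue_vecs)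
qed

lemma card_residue_vecs_not_orthogonal:
  fixes p :: int
  assumes p: "prime p" "p \<noteq> 2" and x: "x \<in> carrier_vec n" "p dvd x \<bullet> x"
  shows "int (card {v \<in> residue_vecs n p. \<not> p dvd x \<bullet> v}) =
    p * int (card {v \<in> residue_vecs n p. \<not> p dvd x \<bullet> v \<and> p dvd v \<bullet> v})"
proof (rule card_residue_vecs_affine[OF p(1) x(1), where e = "\<lambda>v. 2 * (x \<bullet> v)"])
  fix u v :: "int vec" and t
  assume v: "v \<in> carrier_vec n" "\<not> p dvd x \<bullet> v" and u: "vec_cong p u (v + t \<cdot>\<^sub>v x)"
  have carrier: "v + t \<cdot>\<^sub>v x \<in> carrier_vec n" using v x by simp
  have "[x \<bullet> u = x \<bullet> v + t * (x \<bullet> x)] (mod p)"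
    using vec_cong_scalar_prod[OF vec_cong_refl u x(1) carrier] v x
    by (simp add: scalar_prod_add_distrib[of _ n])
  then have not_orthogonal: "\<not> p dvd x \<bullet> u"
    using v(2) x(2) cong_dvd_iff by (metis dvd_add_left_iff dvd_mult)
  have "(v + t \<cdot>\<^sub>v x) \<bullet> (v + t \<cdot>\<^sub>v x) = v \<bullet> v + t * (2 * (x \<bullet> v)) + t * t * (x \<bullet> x)"
    using v x comm_scalar_prod[of v n x] by (simp add: scalar_prod_add_self[of _ n])
  then have "[u \<bullet> u = v \<bullet> v + t * (2 * (x \<bullet> v)) + t * t * (x \<bullet> x)] (mod p)"
    using vec_cong_scalar_prod[OF u u carrier carrier] by simp
  also have "[v \<bullet> v + t * (2 * (x \<bullet> v)) + t * t * (x \<bullet> x) = v \<bullet> v + t * (2 * (x \<bullet> v)) + 0] (mod p)"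
    using x(2) by (intro cong_add cong_refl) (simp add: cong_0_iff)
  finally have "[u \<bullet> u = v \<bullet> v + t * (2 * (x \<bullet> v))] (mod p)" by simp
  with not_orthogonal show "\<not> p dvd x \<bullet> u \<and> [u \<bullet> u = v \<bullet> v + t * (2 * (x \<bullet> v))] (mod p)" ..
qed (use odd_prime_not_dvd_2[OF p] p(1) in \<open>simp add: prime_dvd_mult_iff\<close>)

lemma card_isotropic_not_orthogonal:
  fixes p :: int
  assumes p: "prime p" "p \<noteq> 2" and x: "x \<in> carrier_vec n" "p dvd x \<bullet> x" "\<not> vec_cong p x (0\<^sub>v n)"
  shows "p\<^sup>2 * int (card {v \<in> isotropic n p. \<not> p dvd x \<bullet> v}) = p ^ n * (p - 1)"
proof -
  let ?R = "residue_vecs n p" and ?I = "{v \<in> isotropic n p. \<not> p dvd x \<bullet> v}"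
  have "p dvd x \<bullet> v" if "vec_cong p v (0\<^sub>v n)" for v
    using cong_dvd_iff[OF vec_cong_scalar_prod[OF vec_cong_refl that x(1) zero_carrier_vec]] x(1)
    by simp
  then have "?I = {v \<in> ?R. \<not> p dvd x \<bullet> v \<and> p dvd v \<bullet> v}" by (auto simp: isotropic_def)
  then have not_orthogonal: "int (card {v \<in> ?R. \<not> p dvd x \<bullet> v}) = p * int (card ?I)"
    using card_residue_vecs_not_orthogonal[OF p x(1,2)] by simp
  have "?R = {v \<in> ?R. p dvd x \<bullet> v} \<union> {v \<in> ?R. \<not> p dvd x \<bullet> v}" by blast
  also have "card \<dots> = card {v \<in> ?R. p dvd x \<bullet> v} + card {v \<in> ?R. \<not> p dvd x \<bullet> v}"
    by (rule card_Un_disjoint) (auto intro: finite_subset[OF _ finite_residue_vecs])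
  finally have "p ^ n = int (card {v \<in> ?R. p dvd x \<bullet> v}) + int (card {v \<in> ?R. \<not> p dvd x \<bullet> v})"
    using card_residue_vecs[OF prime_gt_0_int[OF p(1)], of n] by simp
  then have "p * p ^ n = p ^ n + p\<^sup>2 * int (card ?I)"
    using card_residue_vecs_orthogonal[OF p(1) x(1,3)] unfolding not_orthogonal
    by (simp add: distrib_left power2_eq_square)
  then show ?thesis by (simp add: algebra_simps)
qed

definition on_line :: "int \<Rightarrow> int vec \<Rightarrow> int vec \<Rightarrow> bool" where
  "on_line p v y \<longleftrightarrow> (\<exists>a. vec_cong p y (a \<cdot>\<^sub>v v))"

lemma on_line_cong:
  assumes p: "prime p" and c: "\<not> p dvd c" and w: "vec_cong p w (c \<cdot>\<^sub>v v)"
  shows "on_line p w y \<longleftrightarrow> on_line p v y"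
proof -
  have trans: "on_line p v' y" if y: "on_line p w' y" and w': "vec_cong p w' (a \<cdot>\<^sub>v v')" for v' w' a
  proof -
    obtain b where "vec_cong p y (b \<cdot>\<^sub>v w')" using y by (auto simp: on_line_def)
    also have "vec_cong p (b \<cdot>\<^sub>v w') (b \<cdot>\<^sub>v (a \<cdot>\<^sub>v v'))" using w' by (intro vec_cong_smult) auto
    also have "b \<cdot>\<^sub>v (a \<cdot>\<^sub>v v') = (b * a) \<cdot>\<^sub>v v'" by (simp add: smult_smult_assoc)
    finally show ?thesis unfolding on_line_def by blast
  qed
  obtain d where "[c * d = 1] (mod p)" using prime_inverse_cong[OF p c] .
  from vec_cong_smult_swap[OF this w] show ?thesis using trans w by blast
qed

lemma on_lineE:
  assumes "on_line p v y" "v \<in> carrier_vec n"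
  obtains a u where "u \<in> carrier_vec n" "y = a \<cdot>\<^sub>v v + p \<cdot>\<^sub>v u"
proof -
  obtain a where "vec_cong p y (a \<cdot>\<^sub>v v)" using assms(1) by (auto simp: on_line_def)
  then obtain u where "u \<in> carrier_vec n" "y = a \<cdot>\<^sub>v v + p \<cdot>\<^sub>v u"
    by (rule vec_congE) (use assms(2) in auto)
  then show thesis by (rule that)
qed

lemma on_line_carrier: "on_line p v y \<Longrightarrow> v \<in> carrier_vec n \<Longrightarrow> y \<in> carrier_vec n"
  by (metis add_carrier_vec on_lineE smult_carrier_vec)

lemma scalar_prod_smult_self:
  fixes x :: "'a :: comm_ring_1 vec"
  assumes "x \<in> carrier_vec n" shows "(c \<cdot>\<^sub>v x) \<bullet> (c \<cdot>\<^sub>v x) = c\<^sup>2 * (x \<bullet> x)"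
  using assms by (simp add: power2_eq_square)

lemma isotropic_on_line_eq_image:
  fixes p :: int
  assumes p: "prime p" and y: "y \<in> carrier_vec n" "p dvd y \<bullet> y" "\<not> vec_cong p y (0\<^sub>v n)"
  shows "{v \<in> isotropic n p. on_line p v y} = (\<lambda>b. reduce p (b \<cdot>\<^sub>v y)) ` {1..<p}"
proof -
  have p0: "0 < p" using p by (rule prime_gt_0_int)
  have reduce: "reduce p (b \<cdot>\<^sub>v y) \<in> residue_vecs n p"
    "vec_cong p (reduce p (b \<cdot>\<^sub>v y)) (b \<cdot>\<^sub>v y)" for b
    using p0 y(1) by (simp_all add: reduce_residue_vecs vec_cong_reduce)
  show ?thesis
  proof (intro equalityI subsetI)
    fix v assume "v \<in> {v \<in> isotropic n p. on_line p v y}"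
    then have v: "v \<in> residue_vecs n p" and line: "on_line p v y" by (auto simp: isotropic_def)
    obtain a where a: "vec_cong p y (a \<cdot>\<^sub>v v)" using line by (auto simp: on_line_def)
    have "\<not> p dvd a"
      using vec_cong_trans[OF a] vec_cong_smult_zero_iff[OF p residue_vecs_carrier[OF v]] y(3) by blast
    then obtain c where c: "[a * c = 1] (mod p)" "\<not> p dvd c" using prime_inverse_cong[OF p] by blast
    have "vec_cong p (reduce p ((c mod p) \<cdot>\<^sub>v y)) ((c mod p) \<cdot>\<^sub>v y)" by (rule reduce(2))
    also have "vec_cong p \<dots> (c \<cdot>\<^sub>v y)" by (rule vec_cong_smult) simp_all
    also have "vec_cong p \<dots> v" using vec_cong_smult_swap[OF c(1) a] by (rule vec_cong_sym)
    finally have "reduce p ((c mod p) \<cdot>\<^sub>v y) = v" by (rule residue_vecs_eqI[OF reduce(1) v])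
    moreover have "c mod p \<noteq> 0" using c(2) by (simp add: dvd_eq_mod_eq_0)
    then have "c mod p \<in> {1..<p}"
      using p0 pos_mod_sign[OF p0, of c] pos_mod_bound[OF p0, of c] by (simp add: order_less_le)
    ultimately show "v \<in> (\<lambda>b. reduce p (b \<cdot>\<^sub>v y)) ` {1..<p}"
      by (intro image_eqI[of _ _ "c mod p"]) simp_all
  next
    fix v assume "v \<in> (\<lambda>b. reduce p (b \<cdot>\<^sub>v y)) ` {1..<p}"
    then obtain b where "b \<in> {1..<p}" and v: "v = reduce p (b \<cdot>\<^sub>v y)" by blast
    then have b: "\<not> p dvd b" by (simp add: zdvd_not_zless)
    have "[v \<bullet> v = b\<^sup>2 * (y \<bullet> y)] (mod p)"
      using vec_cong_scalar_prod[OF reduce(2) reduce(2)] y(1) unfolding v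
      by (metis scalar_prod_smult_self smult_carrier_vec)
    then have "p dvd v \<bullet> v" using y(2) cong_dvd_iff by (metis dvd_mult)
    moreover have "\<not> vec_cong p v (0\<^sub>v n)"
      using vec_cong_trans[OF vec_cong_sym[OF reduce(2)]] vec_cong_smult_zero_iff[OF p y(1)] b y(3)
      unfolding v by blast
    moreover obtain c where "[b * c = 1] (mod p)" using prime_inverse_cong[OF p b] .
    then have "on_line p v y" unfolding on_line_def v using vec_cong_smult_swap reduce(2) by blast
    ultimately show "v \<in> {v \<in> isotropic n p. on_line p v y}"
      using reduce(1) by (simp add: isotropic_def v)
  qed
qed

lemma inj_on_reduce_smult:
  fixes p :: int
  assumes p: "prime p" and y: "y \<in> carrier_vec n" "\<not> vec_cong p y (0\<^sub>v n)"
  shows "inj_on (\<lambda>b. reduce p (b \<cdot>\<^sub>v y)) {0..<p}"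
proof (rule inj_onI)
  obtain j where j: "j < n" "\<not> p dvd y $ j" using y(2,1) by (rule not_vec_cong_zeroE)
  fix b b' assume b: "b \<in> {0..<p}" "b' \<in> {0..<p}" "reduce p (b \<cdot>\<^sub>v y) = reduce p (b' \<cdot>\<^sub>v y)"
  then have "vec_cong p (b \<cdot>\<^sub>v y) (b' \<cdot>\<^sub>v y)" by (metis vec_cong_reduce vec_cong_sym vec_cong_trans)
  then have "[b * y $ j = b' * y $ j] (mod p)" using y(1) j(1) by (auto simp: vec_cong_def)
  moreover have "coprime (y $ j) p" using p j(2) by (metis coprime_commute prime_imp_coprime)
  ultimately have "[b = b'] (mod p)" by (simp add: cong_mult_rcancel)
  then show "b = b'" using b by (simp add: cong_def)
qed

lemma card_isotropic_on_line:
  fixes p :: int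
  assumes p: "prime p" and y: "y \<in> carrier_vec n" "p dvd y \<bullet> y" "\<not> vec_cong p y (0\<^sub>v n)"
  shows "card {v \<in> isotropic n p. on_line p v y} = nat p - 1"
proof -
  have "inj_on (\<lambda>b. reduce p (b \<cdot>\<^sub>v y)) {1..<p}"
    using inj_on_reduce_smult[OF p y(1,3)] by (rule inj_on_subset) auto
  then show ?thesis
    unfolding isotropic_on_line_eq_image[OF assms] by (simp add: card_image nat_diff_distrib')
qed

lemma isotropic_other_coordinate:
  fixes p :: int
  assumes p: "prime p" and v: "v \<in> carrier_vec n" "p dvd v \<bullet> v" and i: "i < n" "\<not> p dvd v $ i"
  obtains j where "j < n" "j \<noteq> i" "\<not> p dvd v $ j"
proof -
  have "\<not> (\<forall>j\<in>{0..<n} - {i}. p dvd v $ j)"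
  proof
    assume "\<forall>j\<in>{0..<n} - {i}. p dvd v $ j"
    then have "p dvd (\<Sum>j\<in>{0..<n} - {i}. v $ j * v $ j)" by (intro dvd_sum dvd_mult) auto
    moreover have "v \<bullet> v = v $ i * v $ i + (\<Sum>j\<in>{0..<n} - {i}. v $ j * v $ j)"
      using v(1) i(1) by (simp add: scalar_prod_def sum.remove[of _ i])
    ultimately have "p dvd v $ i * v $ i" using v(2) by (simp add: dvd_add_left_iff)
    then show False using i(2) p by (simp add: prime_dvd_mult_iff)
  qed
  then obtain j where "j \<in> {0..<n} - {i}" "\<not> p dvd v $ j" by blast
  then show thesis by (intro that[of j]) auto
qed

lemma isotropic_lift:
  fixes p :: int
  assumes p: "prime p" "p \<noteq> 2" and v: "v \<in> carrier_vec n" "p dvd v \<bullet> v" "\<not> vec_cong p v (0\<^sub>v n)"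
  obtains c w i where "\<not> p dvd c" "w \<in> carrier_vec n" "vec_cong p w (c \<cdot>\<^sub>v v)" "p\<^sup>2 dvd w \<bullet> w"
    "i < n" "w $ i = 1"
proof -
  obtain i where i: "i < n" "\<not> p dvd v $ i" using v(3,1) by (rule not_vec_cong_zeroE)
  obtain j where j: "j < n" "j \<noteq> i" "\<not> p dvd v $ j"
    using isotropic_other_coordinate[OF p(1) v(1,2) i] .
  obtain c where c: "[v $ i * c = 1] (mod p)" "\<not> p dvd c" using prime_inverse_cong[OF p(1) i(2)] .
  define u where "u = c \<cdot>\<^sub>v v + (1 - v $ i * c) \<cdot>\<^sub>v unit_vec n i"
  have u: "u \<in> carrier_vec n" "u $ i = 1" "u $ j = c * v $ j" using v i j by (simp_all add: u_def)
  have cong: "vec_cong p u (c \<cdot>\<^sub>v v)"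
    using v(1) cong_sym[OF c(1)] by (auto simp: vec_cong_def u_def unit_vec_def cong_iff_dvd_diff)
  have "[u \<bullet> u = c\<^sup>2 * (v \<bullet> v)] (mod p)"
    using vec_cong_scalar_prod[OF cong cong] v(1)
    by (metis scalar_prod_smult_self smult_carrier_vec)
  then have "p dvd u \<bullet> u" using v(2) cong_dvd_iff by (metis dvd_mult)
  then obtain s where s: "u \<bullet> u = p * s" ..
  have "\<not> p dvd 2 * u $ j"
    using odd_prime_not_dvd_2[OF p] p(1) c(2) j(3) by (simp add: u(3) prime_dvd_mult_iff)
  then obtain b where b: "[2 * u $ j * b = 1] (mod p)" using prime_inverse_cong[OF p(1)] by metis
  define t where "t = - s * b"
  define w where "w = u + (p * t) \<cdot>\<^sub>v unit_vec n j"
  have "w \<bullet> w = p * (- s * (2 * u $ j * b - 1)) + p\<^sup>2 * (t * t)"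
    using u j
    by (simp add: w_def scalar_prod_add_self[of _ n] s t_def power2_eq_square algebra_simps)
  moreover have "p\<^sup>2 dvd p * (- s * (2 * u $ j * b - 1))"
    unfolding power2_eq_square
    using b by (intro mult_dvd_mono dvd_refl dvd_mult) (simp add: cong_iff_dvd_diff)
  ultimately have "p\<^sup>2 dvd w \<bullet> w" by simp
  moreover have "vec_cong p w u" using u j by (auto simp: vec_cong_def w_def cong_iff_dvd_diff)
  then have "vec_cong p w (c \<cdot>\<^sub>v v)" using cong by (rule vec_cong_trans)
  moreover have "w \<in> carrier_vec n" "w $ i = 1" using u i j by (simp_all add: w_def)
  ultimately show thesis using that c(2) i(1) by blast
qed

section \<open>Neighbours of the standard lattice\<close>

text \<open>For \<open>v\<close> with \<open>p\<^sup>2\<close> dividing \<open>v \<bullet> v\<close> this is \<open>p\<close> times the \<open>p\<close>-neighbour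
  \<open>{x \<in> \<int>\<^sup>n. p dvd x \<bullet> v} + \<int> (v / p)\<close> of \<open>\<int>\<^sup>n\<close>.\<close>

definition neighbour :: "int \<Rightarrow> int vec \<Rightarrow> int vec set" where
  "neighbour p v = {y. on_line p v y \<and> p\<^sup>2 dvd y \<bullet> v}"

lemma neighbour_scalar_prod_dvd:
  assumes y: "y \<in> neighbour p v" and y': "y' \<in> neighbour p v"
    and v: "v \<in> carrier_vec n" "p\<^sup>2 dvd v \<bullet> v"
  shows "p\<^sup>2 dvd y \<bullet> y'"
proof -
  obtain a u where u: "u \<in> carrier_vec n" "y = a \<cdot>\<^sub>v v + p \<cdot>\<^sub>v u"
    using y v(1) by (auto simp: neighbour_def elim: on_lineE)
  obtain a' u' where u': "u' \<in> carrier_vec n" "y' = a' \<cdot>\<^sub>v v + p \<cdot>\<^sub>v u'"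
    using y' v(1) by (auto simp: neighbour_def elim: on_lineE)
  have "y' \<bullet> v = a' * (v \<bullet> v) + p * (v \<bullet> u')"
    using u' v comm_scalar_prod[of u' n v] by (simp add: add_scalar_prod_distrib[of _ n])
  then have u'_v: "p\<^sup>2 dvd p * (v \<bullet> u')"
    using y' v(2) by (simp add: neighbour_def dvd_add_right_iff)
  have "y \<bullet> y' = a' * (y \<bullet> v) + p * (y \<bullet> u')"
    using u u' v by (simp add: scalar_prod_add_distrib[of _ n])
  also have "y \<bullet> u' = a * (v \<bullet> u') + p * (u \<bullet> u')"
    using u u' v by (simp add: add_scalar_prod_distrib[of _ n])
  finally have "y \<bullet> y' = a' * (y \<bullet> v) + a * (p * (v \<bullet> u')) + p\<^sup>2 * (u \<bullet> u')"
    by (simp add: algebra_simps power2_eq_square)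
  then show ?thesis using y u'_v by (simp add: neighbour_def)
qed

lemma det_replace_col_one:
  assumes "v \<in> carrier_vec n" "i < n" shows "det (replace_col (1\<^sub>m n) v i) = v $ i"
  using cramer_lemma_mat[of "1\<^sub>m n" n v i] assms by simp

lemma replace_col_carrier [simp]: "A \<in> carrier_mat nr nc \<Longrightarrow> replace_col A v i \<in> carrier_mat nr nc"
  by (simp add: replace_col_def)

lemma replace_col_one_mult_vec:
  fixes v z :: "'a :: comm_ring_1 vec"
  assumes "v \<in> carrier_vec n" "z \<in> carrier_vec n" "i < n"
  shows "replace_col (1\<^sub>m n) v i *\<^sub>v z = z + z $ i \<cdot>\<^sub>v (v - unit_vec n i)"
proof (rule eq_vecI)
  fix k assume "k < dim_vec (z + z $ i \<cdot>\<^sub>v (v - unit_vec n i))"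
  then have k: "k < n" using assms by simp
  have "row (replace_col (1\<^sub>m n) v i) k
      = unit_vec n k + (v $ k - unit_vec n i $ k) \<cdot>\<^sub>v unit_vec n i"
    using assms k by (intro eq_vecI) (auto simp: replace_col_def)
  then show "(replace_col (1\<^sub>m n) v i *\<^sub>v z) $ k = (z + z $ i \<cdot>\<^sub>v (v - unit_vec n i)) $ k"
    using assms k by (simp add: add_scalar_prod_distrib[of _ n] replace_col_def)
qed (use assms in \<open>simp add: replace_col_def\<close>)

lemma transpose_replace_col_one_mult_vec:
  fixes v z :: "'a :: comm_ring_1 vec"
  assumes "v \<in> carrier_vec n" "z \<in> carrier_vec n" "i < n"
  shows "transpose_mat (replace_col (1\<^sub>m n) v i) *\<^sub>v z = z + (v \<bullet> z - z $ i) \<cdot>\<^sub>v unit_vec n i"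
proof (rule eq_vecI)
  fix k assume "k < dim_vec (z + (v \<bullet> z - z $ i) \<cdot>\<^sub>v unit_vec n i)"
  then have k: "k < n" using assms by simp
  have "col (replace_col (1\<^sub>m n) v i) k = (if k = i then v else unit_vec n k)"
    using assms k by (intro eq_vecI) (auto simp: replace_col_def)
  then show "(transpose_mat (replace_col (1\<^sub>m n) v i) *\<^sub>v z) $ k
      = (z + (v \<bullet> z - z $ i) \<cdot>\<^sub>v unit_vec n i) $ k"
    using assms k by (auto simp: replace_col_def)
qed (use assms in \<open>simp add: replace_col_def\<close>)

lemma orthogonal_mod_basis:
  fixes p :: int
  assumes p: "prime p" and w: "w \<in> carrier_vec n" and j: "j < n" "\<not> p dvd w $ j"
  obtains B where "B \<in> carrier_mat n n" "det B = p"
    "(*\<^sub>v) B ` carrier_vec n = {x \<in> carrier_vec n. p dvd w \<bullet> x}"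
proof -
  obtain b where b: "[w $ j * b = 1] (mod p)" "\<not> p dvd b" using prime_inverse_cong[OF p j(2)] .
  define r where "r = (b * w $ j + p) \<cdot>\<^sub>v unit_vec n j - b \<cdot>\<^sub>v w"
  define B where "B = transpose_mat (replace_col (1\<^sub>m n) r j)"
  have r: "r \<in> carrier_vec n" "r $ j = p" using w j by (simp_all add: r_def)
  have r_prod: "r \<bullet> z = (b * w $ j + p) * z $ j - b * (w \<bullet> z)" if "z \<in> carrier_vec n" for z
    using that w j by (simp add: r_def minus_scalar_prod_distrib[of _ n])
  have mult: "B *\<^sub>v z = z + (r \<bullet> z - z $ j) \<cdot>\<^sub>v unit_vec n j" if "z \<in> carrier_vec n" for z
    unfolding B_def using r(1) that j(1) by (rule transpose_replace_col_one_mult_vec)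
  show thesis
  proof (rule that)
    show B: "B \<in> carrier_mat n n" by (simp add: B_def)
    show "det B = p"
      using det_transpose[of "replace_col (1\<^sub>m n) r j" n] det_replace_col_one[OF r(1) j(1)] r(2)
      by (simp add: B_def)
    show "(*\<^sub>v) B ` carrier_vec n = {x \<in> carrier_vec n. p dvd w \<bullet> x}"
    proof (intro equalityI subsetI)
      fix x assume "x \<in> (*\<^sub>v) B ` carrier_vec n"
      then obtain z where z: "z \<in> carrier_vec n" and x: "x = B *\<^sub>v z" by blast
      have "w \<bullet> x = w \<bullet> z + (r \<bullet> z - z $ j) * w $ j"
        using w z j by (simp add: x mult scalar_prod_add_distrib[of _ n])
      also have "\<dots> = w $ j * z $ j * p - (w $ j * b - 1) * (w \<bullet> z - z $ j * w $ j)"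
        by (simp add: r_prod[OF z] algebra_simps)
      also have "p dvd \<dots>"
        using b(1) by (intro dvd_diff[OF dvd_triv_right dvd_mult2]) (simp add: cong_iff_dvd_diff)
      finally show "x \<in> {x \<in> carrier_vec n. p dvd w \<bullet> x}" using B z by (simp add: x)
    next
      fix x assume x: "x \<in> {x \<in> carrier_vec n. p dvd w \<bullet> x}"
      have "x $ j - r \<bullet> x = b * (w \<bullet> x) - (w $ j * b - 1) * x $ j - p * x $ j"
        using x by (simp add: r_prod algebra_simps)
      also have "p dvd \<dots>" using b(1) x by (intro dvd_diff) (simp_all add: cong_iff_dvd_diff)
      finally obtain t where t: "x $ j - r \<bullet> x = p * t" ..
      let ?z = "x + t \<cdot>\<^sub>v unit_vec n j"
      have "r \<bullet> ?z = x $ j"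
        using x r j t by (simp add: scalar_prod_add_distrib[of _ n] algebra_simps)
      moreover have "?z + (x $ j - ?z $ j) \<cdot>\<^sub>v unit_vec n j = x"
        using x j by (intro eq_vecI) auto
      ultimately have "B *\<^sub>v ?z = x" using x by (subst mult) auto
      then show "x \<in> (*\<^sub>v) B ` carrier_vec n" using x by (intro image_eqI[of _ _ ?z]) auto
    qed
  qed
qed

lemma mat_diag_mult_vec:
  fixes f :: "nat \<Rightarrow> 'a :: comm_ring_1"
  assumes "z \<in> carrier_vec n" shows "mat_diag n f *\<^sub>v z = vec n (\<lambda>k. f k * z $ k)"
proof (rule eq_vecI)
  fix k assume "k < dim_vec (vec n (\<lambda>k. f k * z $ k))"
  then have k: "k < n" by simp
  then have "row (mat_diag n f) k = f k \<cdot>\<^sub>v unit_vec n k"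
    by (intro eq_vecI) (auto simp: mat_diag_def)
  then show "(mat_diag n f *\<^sub>v z) $ k = vec n (\<lambda>k. f k * z $ k) $ k"
    using assms k by (simp add: mat_diag_def)
qed (simp add: mat_diag_def)

lemma det_mat_diag: "det (mat_diag n f) = (\<Prod>k<n. f k)"
proof -
  have "det (mat_diag n f) = prod_list (diag_mat (mat_diag n f))"
    by (rule det_upper_triangular[of _ n]) (auto simp: mat_diag_def)
  then show ?thesis by (simp add: prod_list_diag_prod mat_diag_def atLeast0LessThan)
qed

lemma line_lattice_basis:
  fixes p :: int
  assumes v: "v \<in> carrier_vec n" and i: "i < n" "v $ i = 1"
  obtains A where "A \<in> carrier_mat n n" "det A = p ^ (n - 1)"
    "\<And>x. x \<in> carrier_vec n \<Longrightarrow> A *\<^sub>v x = x $ i \<cdot>\<^sub>v v + p \<cdot>\<^sub>v (x - x $ i \<cdot>\<^sub>v unit_vec n i)"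
proof -
  define D where "D = mat_diag n (\<lambda>k. if k = i then 1 else p)"
  let ?A = "replace_col (1\<^sub>m n) v i * D"
  have D: "D \<in> carrier_mat n n" by (simp add: D_def)
  show thesis
  proof (rule that)
    show "?A \<in> carrier_mat n n" by (rule mult_carrier_mat[OF _ D]) simp
    have "det D = p ^ (n - 1)"
      using i(1) by (simp add: D_def det_mat_diag prod.remove[of _ i] prod.If_cases)
    then show "det ?A = p ^ (n - 1)"
      using det_mult[of "replace_col (1\<^sub>m n) v i" n D] D det_replace_col_one[OF v i(1)] i(2) by simp
    fix x :: "int vec" assume x: "x \<in> carrier_vec n"
    then have "?A *\<^sub>v x = replace_col (1\<^sub>m n) v i *\<^sub>v (D *\<^sub>v x)"
      using D by (intro assoc_mult_mat_vec[of _ n n _ n]) auto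
    also have "\<dots> = D *\<^sub>v x + (D *\<^sub>v x) $ i \<cdot>\<^sub>v (v - unit_vec n i)"
      using D x v i(1) by (intro replace_col_one_mult_vec) auto
    also have "\<dots> = x $ i \<cdot>\<^sub>v v + p \<cdot>\<^sub>v (x - x $ i \<cdot>\<^sub>v unit_vec n i)"
      unfolding D_def mat_diag_mult_vec[OF x]
      using x v i by (intro eq_vecI) (auto simp: algebra_simps)
    finally show "?A *\<^sub>v x = x $ i \<cdot>\<^sub>v v + p \<cdot>\<^sub>v (x - x $ i \<cdot>\<^sub>v unit_vec n i)" .
  qed
qed

text \<open>In the basis \<open>v\<close>, \<open>p e\<^sub>k\<close> (\<open>k \<noteq> i\<close>) of the lattice of all vectors on the line of \<open>v\<close>, the
  second condition on a neighbour becomes a linear congruence modulo \<open>p\<close>.\<close>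

lemma neighbour_eq_image_orthogonal:
  fixes p :: int
  assumes p: "p \<noteq> 0" and v: "v \<in> carrier_vec n" "p\<^sup>2 dvd v \<bullet> v" and i: "i < n"
    and mult: "\<And>x. x \<in> carrier_vec n \<Longrightarrow> A *\<^sub>v x = x $ i \<cdot>\<^sub>v v + p \<cdot>\<^sub>v (x - x $ i \<cdot>\<^sub>v unit_vec n i)"
    and unit: "v $ i = 1"
  shows "neighbour p v = (*\<^sub>v) A ` {x \<in> carrier_vec n. p dvd (v - unit_vec n i) \<bullet> x}"
proof -
  have second: "p\<^sup>2 dvd (A *\<^sub>v x) \<bullet> v \<longleftrightarrow> p dvd (v - unit_vec n i) \<bullet> x"
    if x: "x \<in> carrier_vec n" for x
  proof -
    have "(A *\<^sub>v x) \<bullet> v = x $ i * (v \<bullet> v) + p * ((v - unit_vec n i) \<bullet> x)"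
      using x v(1) i unit comm_scalar_prod[of v n x]
      by (simp add: mult add_scalar_prod_distrib[of _ n] minus_scalar_prod_distrib[of _ n])
    then have "p\<^sup>2 dvd (A *\<^sub>v x) \<bullet> v \<longleftrightarrow> p\<^sup>2 dvd p * ((v - unit_vec n i) \<bullet> x)"
      using v(2) by (simp add: dvd_add_right_iff)
    then show ?thesis using p by (simp add: power2_eq_square)
  qed
  show ?thesis
  proof (intro equalityI subsetI)
    fix y assume y: "y \<in> neighbour p v"
    then obtain a u where u: "u \<in> carrier_vec n" and yu: "y = a \<cdot>\<^sub>v v + p \<cdot>\<^sub>v u"
      using v(1) by (auto simp: neighbour_def elim: on_lineE)
    define x where "x = u - u $ i \<cdot>\<^sub>v v + y $ i \<cdot>\<^sub>v unit_vec n i"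
    have x: "x \<in> carrier_vec n" using u v by (simp add: x_def)
    have "A *\<^sub>v x = y"
      unfolding mult[OF x] using u v i unit by (intro eq_vecI) (auto simp: x_def yu algebra_simps)
    moreover from this have "p dvd (v - unit_vec n i) \<bullet> x"
      using y second[OF x] by (simp add: neighbour_def)
    ultimately show "y \<in> (*\<^sub>v) A ` {x \<in> carrier_vec n. p dvd (v - unit_vec n i) \<bullet> x}"
      using x by blast
  next
    fix y assume "y \<in> (*\<^sub>v) A ` {x \<in> carrier_vec n. p dvd (v - unit_vec n i) \<bullet> x}"
    then obtain x where x: "x \<in> carrier_vec n" "p dvd (v - unit_vec n i) \<bullet> x" and y: "y = A *\<^sub>v x"
      by blast
    have "vec_cong p y (x $ i \<cdot>\<^sub>v v)"
      using x v(1) unfolding y mult[OF x(1)] vec_cong_def by (auto simp: cong_iff_dvd_diff)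
    then show "y \<in> neighbour p v"
      using second[OF x(1)] x(2) by (auto simp: neighbour_def on_line_def y)
  qed
qed

lemma card_neighbour:
  fixes p k :: int
  assumes p: "prime p" and n: "n \<le> 5" and v: "v \<in> carrier_vec n" "p\<^sup>2 dvd v \<bullet> v"
    and i: "i < n" "v $ i = 1"
  shows "card {y \<in> neighbour p v. y \<bullet> y = p\<^sup>2 * k} = card (reps n k)"
proof -
  have p0: "0 < p" using p by (rule prime_gt_0_int)
  have "p dvd v \<bullet> v" using v(2) by (meson dvd_power dvd_trans pos2)
  moreover have "\<not> p dvd v $ i" using p i(2) not_prime_unit[of p] by auto
  ultimately obtain j where j: "j < n" "j \<noteq> i" "\<not> p dvd v $ j"
    using isotropic_other_coordinate[OF p v(1) _ i(1)] by blast
  let ?w = "v - unit_vec n i"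
  obtain A where A: "A \<in> carrier_mat n n" "det A = p ^ (n - 1)"
    and mult_A: "\<And>x. x \<in> carrier_vec n \<Longrightarrow> A *\<^sub>v x = x $ i \<cdot>\<^sub>v v + p \<cdot>\<^sub>v (x - x $ i \<cdot>\<^sub>v unit_vec n i)"
    using line_lattice_basis[OF v(1) i] by metis
  have neighbour_A: "neighbour p v = (*\<^sub>v) A ` {x \<in> carrier_vec n. p dvd ?w \<bullet> x}"
    using p0 by (intro neighbour_eq_image_orthogonal v i mult_A) simp
  have "?w \<in> carrier_vec n" "\<not> p dvd ?w $ j" using v(1) i j by simp_all
  then obtain B where B: "B \<in> carrier_mat n n" "det B = p"
    and image_B: "(*\<^sub>v) B ` carrier_vec n = {x \<in> carrier_vec n. p dvd ?w \<bullet> x}"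
    using orthogonal_mod_basis[OF p _ j(1)] by metis
  have neighbour_AB: "neighbour p v = (*\<^sub>v) (A * B) ` carrier_vec n"
    unfolding neighbour_A image_B[symmetric] image_image
    using A B by (intro image_cong refl assoc_mult_mat_vec[symmetric])
  have "p ^ (n - 1) * p = p ^ n" using i(1) by (simp flip: power_Suc2)
  then have det: "(det (A * B))\<^sup>2 = (p\<^sup>2) ^ n"
    using A B by (simp add: det_mult[of _ n] power_mult[symmetric] mult.commute)
  show ?thesis
    unfolding neighbour_AB
  proof (rule card_scaled_unimodular_sublattice[OF _ _ det n])
    show "A * B \<in> carrier_mat n n" using A(1) B(1) by (rule mult_carrier_mat)
    show "0 < p\<^sup>2" using p0 by simp
    fix x y :: "int vec" assume "x \<in> carrier_vec n" "y \<in> carrier_vec n"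
    then have "A * B *\<^sub>v x \<in> neighbour p v" "A * B *\<^sub>v y \<in> neighbour p v"
      unfolding neighbour_AB by simp_all
    then show "p\<^sup>2 dvd (A * B *\<^sub>v x) \<bullet> (A * B *\<^sub>v y)" by (rule neighbour_scalar_prod_dvd[OF _ _ v])
  qed
qed

section \<open>Representations of \<open>p\<^sup>2k\<close> by sums of squares\<close>

definition prim_reps :: "nat \<Rightarrow> int \<Rightarrow> int \<Rightarrow> int vec set" where
  "prim_reps n p k = {x \<in> reps n k. \<not> vec_cong p x (0\<^sub>v n)}"

lemma finite_prim_reps: "finite (prim_reps n p k)"
  by (rule finite_subset[OF _ finite_reps[of n k]]) (auto simp: prim_reps_def)

lemma inj_smult_vec:
  fixes c :: "'a :: idom"
  assumes "c \<noteq> 0" shows "inj ((\<cdot>\<^sub>v) c)"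
proof (rule injI, rule eq_vecI)
  fix x y :: "'a vec" assume eq: "c \<cdot>\<^sub>v x = c \<cdot>\<^sub>v y"
  show "dim_vec x = dim_vec y" using arg_cong[OF eq, of dim_vec] by simp
  fix i assume "i < dim_vec y"
  then show "x $ i = y $ i"
    using arg_cong[OF eq, of "\<lambda>v. v $ i"] \<open>dim_vec x = dim_vec y\<close> assms by simp
qed

lemma reps_square_eq:
  assumes "p \<noteq> 0" shows "reps n (p\<^sup>2 * k) = prim_reps n p (p\<^sup>2 * k) \<union> (\<cdot>\<^sub>v) p ` reps n k"
proof (intro equalityI subsetI)
  fix y assume y: "y \<in> reps n (p\<^sup>2 * k)"
  show "y \<in> prim_reps n p (p\<^sup>2 * k) \<union> (\<cdot>\<^sub>v) p ` reps n k"
  proof (cases "vec_cong p y (0\<^sub>v n)")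
    case True
    then obtain x where x: "x \<in> carrier_vec n" "y = 0\<^sub>v n + p \<cdot>\<^sub>v x"
      using vec_congE[OF _ zero_carrier_vec] by blast
    then have eq: "y = p \<cdot>\<^sub>v x" by simp
    have "p\<^sup>2 * (x \<bullet> x) = p\<^sup>2 * k"
      using y scalar_prod_smult_self[OF x(1), of p] by (simp add: reps_def eq)
    then have "x \<in> reps n k" using x(1) assms by (simp add: reps_def)
    then show ?thesis using eq by blast
  qed (use y in \<open>simp add: prim_reps_def\<close>)
qed (auto simp: prim_reps_def reps_def power2_eq_square)

lemma prim_reps_smult_disjoint: "prim_reps n p m \<inter> (\<cdot>\<^sub>v) p ` A = {}"
  by (auto simp: prim_reps_def reps_def vec_cong_zero_iff)

lemma card_reps_square:
  assumes "p \<noteq> 0" shows "card (reps n (p\<^sup>2 * k)) = card (prim_reps n p (p\<^sup>2 * k)) + card (reps n k)"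
proof -
  have "card (reps n (p\<^sup>2 * k)) = card (prim_reps n p (p\<^sup>2 * k)) + card ((\<cdot>\<^sub>v) p ` reps n k)"
    unfolding reps_square_eq[OF assms]
    by (intro card_Un_disjoint finite_prim_reps finite_imageI finite_reps prim_reps_smult_disjoint)
  then show ?thesis using inj_smult_vec[OF assms] by (simp add: card_image inj_on_subset)
qed

lemma on_line_prim_mem_neighbour:
  fixes p :: int
  assumes p: "prime p" "p \<noteq> 2" and w: "w \<in> carrier_vec n" "p\<^sup>2 dvd w \<bullet> w"
    and y: "on_line p w y" "\<not> vec_cong p y (0\<^sub>v n)" "p\<^sup>2 dvd y \<bullet> y"
  shows "y \<in> neighbour p w"
proof -
  obtain a u where u: "u \<in> carrier_vec n" and yu: "y = a \<cdot>\<^sub>v w + p \<cdot>\<^sub>v u"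
    using y(1) w(1) by (rule on_lineE)
  have "\<not> p dvd a" using y(2) w(1) u by (auto simp: yu vec_cong_zero_iff)
  have "y \<bullet> y = a\<^sup>2 * (w \<bullet> w) + p * (2 * a * (w \<bullet> u)) + p\<^sup>2 * (u \<bullet> u)"
    unfolding yu
    using w u by (simp add: scalar_prod_add_self[of _ n] power2_eq_square algebra_simps)
  then have "p * (2 * a * (w \<bullet> u)) = y \<bullet> y - a\<^sup>2 * (w \<bullet> w) - p\<^sup>2 * (u \<bullet> u)" by simp
  also have "p\<^sup>2 dvd \<dots>" using w(2) y(3) by simp
  finally have "p dvd 2 * a * (w \<bullet> u)" using p(1) by (auto simp: power2_eq_square)
  then have "p dvd w \<bullet> u"
    using p(1) odd_prime_not_dvd_2[OF p] \<open>\<not> p dvd a\<close> by (simp add: prime_dvd_mult_iff)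
  then have "p\<^sup>2 dvd p * (w \<bullet> u)" by (simp add: power2_eq_square)
  moreover have "y \<bullet> w = a * (w \<bullet> w) + p * (w \<bullet> u)"
    unfolding yu using w u comm_scalar_prod[of u n w] by (simp add: add_scalar_prod_distrib[of _ n])
  ultimately show ?thesis using w(2) y(1) by (simp add: neighbour_def)
qed

lemma smult_mem_neighbour_iff:
  fixes p :: int
  assumes "p \<noteq> 0" "w \<in> carrier_vec n" "x \<in> carrier_vec n"
  shows "p \<cdot>\<^sub>v x \<in> neighbour p w \<longleftrightarrow> p dvd x \<bullet> w"
proof -
  have "vec_cong p (p \<cdot>\<^sub>v x) (0 \<cdot>\<^sub>v w)" using assms(2,3) by (simp add: vec_cong_def cong_0_iff)
  then have "on_line p w (p \<cdot>\<^sub>v x)" unfolding on_line_def by blast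
  then show ?thesis using assms by (simp add: neighbour_def power2_eq_square)
qed

lemma neighbour_reps_eq:
  fixes p :: int
  assumes p: "prime p" "p \<noteq> 2" and w: "w \<in> carrier_vec n" "p\<^sup>2 dvd w \<bullet> w"
  shows "{y \<in> neighbour p w. y \<bullet> y = p\<^sup>2 * k} =
    {y \<in> prim_reps n p (p\<^sup>2 * k). on_line p w y} \<union> (\<cdot>\<^sub>v) p ` {x \<in> reps n k. p dvd x \<bullet> w}"
proof -
  have p0: "p \<noteq> 0" using p(1) by auto
  have "{y \<in> neighbour p w. y \<bullet> y = p\<^sup>2 * k} = {y \<in> reps n (p\<^sup>2 * k). y \<in> neighbour p w}"
    using on_line_carrier[OF _ w(1)] by (auto simp: reps_def neighbour_def)
  also have "\<dots> = {y \<in> prim_reps n p (p\<^sup>2 * k). y \<in> neighbour p w}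
      \<union> {y \<in> (\<cdot>\<^sub>v) p ` reps n k. y \<in> neighbour p w}"
    unfolding reps_square_eq[OF p0] by blast
  also have "{y \<in> prim_reps n p (p\<^sup>2 * k). y \<in> neighbour p w}
      = {y \<in> prim_reps n p (p\<^sup>2 * k). on_line p w y}"
    using on_line_prim_mem_neighbour[OF p w] by (auto simp: prim_reps_def reps_def neighbour_def)
  also have "{y \<in> (\<cdot>\<^sub>v) p ` reps n k. y \<in> neighbour p w} = (\<cdot>\<^sub>v) p ` {x \<in> reps n k. p dvd x \<bullet> w}"
    by (auto simp: reps_def smult_mem_neighbour_iff[OF p0 w(1)])
  finally show ?thesis .
qed

text \<open>The right-hand side counts the vectors of norm \<open>k\<close> of \<open>\<int>\<^sup>n\<close> that do not lie in its neighbour,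
  the left-hand side those of the neighbour that do not lie in \<open>\<int>\<^sup>n\<close>. By \<open>card_neighbour\<close> both lattices
  have the same number of vectors of norm \<open>k\<close>.\<close>

lemma card_prim_reps_on_line:
  fixes p k :: int
  assumes p: "prime p" "p \<noteq> 2" and n: "n \<le> 5" and v: "v \<in> isotropic n p"
  shows "card {y \<in> prim_reps n p (p\<^sup>2 * k). on_line p v y}
      = card {x \<in> prim_reps n p k. \<not> p dvd x \<bullet> v}"
proof -
  have p0: "p \<noteq> 0" using p(1) by auto
  have v: "v \<in> carrier_vec n" "p dvd v \<bullet> v" "\<not> vec_cong p v (0\<^sub>v n)"
    using v residue_vecs_carrier by (auto simp: isotropic_def)
  obtain c w i where c: "\<not> p dvd c" and w: "w \<in> carrier_vec n" and wv: "vec_cong p w (c \<cdot>\<^sub>v v)"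
    and ww: "p\<^sup>2 dvd w \<bullet> w" and i: "i < n" "w $ i = 1"
    using isotropic_lift[OF p v] .
  define A B C where "A = {y \<in> prim_reps n p (p\<^sup>2 * k). on_line p v y}"
    and "B = {x \<in> prim_reps n p k. \<not> p dvd x \<bullet> v}" and "C = {x \<in> reps n k. p dvd x \<bullet> v}"
  have "p dvd x \<bullet> w \<longleftrightarrow> p dvd x \<bullet> v" if "x \<in> carrier_vec n" for x
  proof -
    have "[x \<bullet> w = x \<bullet> (c \<cdot>\<^sub>v v)] (mod p)"
      using that v(1) by (intro vec_cong_scalar_prod[OF vec_cong_refl wv]) auto
    then have "p dvd x \<bullet> w \<longleftrightarrow> p dvd c * (x \<bullet> v)" using that v(1) by (simp add: cong_dvd_iff)
    then show ?thesis using p(1) c by (simp add: prime_dvd_mult_iff)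
  qed
  then have "{x \<in> reps n k. p dvd x \<bullet> w} = C" by (auto simp: C_def reps_def)
  then have "card (reps n k) = card (A \<union> (\<cdot>\<^sub>v) p ` C)"
    using card_neighbour[OF p(1) n w ww i, of k]
    by (simp add: neighbour_reps_eq[OF p w ww] A_def on_line_cong[OF p(1) c wv])
  also have "\<dots> = card A + card ((\<cdot>\<^sub>v) p ` C)"
  proof (rule card_Un_disjoint)
    show "finite A" using finite_prim_reps by (simp add: A_def)
    show "finite ((\<cdot>\<^sub>v) p ` C)" using finite_reps by (simp add: C_def)
    show "A \<inter> (\<cdot>\<^sub>v) p ` C = {}" unfolding A_def using prim_reps_smult_disjoint by blast
  qed
  also have "card ((\<cdot>\<^sub>v) p ` C) = card C"
    by (rule card_image[OF inj_on_subset[OF inj_smult_vec[OF p0] subset_UNIV]])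
  finally have "card (reps n k) = card A + card C" .
  moreover have "p dvd x \<bullet> v" if "vec_cong p x (0\<^sub>v n)" for x
    using cong_dvd_iff[OF vec_cong_scalar_prod[OF that vec_cong_refl zero_carrier_vec v(1)]] v(1)
    by simp
  then have "reps n k = B \<union> C" by (auto simp: B_def C_def prim_reps_def)
  moreover have "card (B \<union> C) = card B + card C"
    using finite_prim_reps finite_reps by (intro card_Un_disjoint) (auto simp: B_def C_def)
  ultimately show ?thesis by (simp add: A_def B_def)
qed

theorem card_prim_reps_square:
  fixes p k :: int
  assumes p: "prime p" "p \<noteq> 2" and n: "2 \<le> n" "n \<le> 5" and k: "p dvd k"
  shows "int (card (prim_reps n p (p\<^sup>2 * k))) = p ^ (n - 2) * int (card (prim_reps n p k))"
proof -
  have p1: "1 < p" using p(1) by (rule prime_gt_1_int)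
  define V Y X where "V = isotropic n p" and "Y = prim_reps n p (p\<^sup>2 * k)" and "X = prim_reps n p k"
  have "\<forall>y\<in>Y. card {v \<in> V. on_line p v y} = nat p - 1"
    unfolding V_def Y_def using card_isotropic_on_line[OF p(1)]
    by (simp add: prim_reps_def reps_def power2_eq_square)
  then have "(\<Sum>v\<in>V. card {y \<in> Y. on_line p v y}) = (\<Sum>y\<in>Y. nat p - 1)"
    unfolding V_def Y_def by (rule sum_multicount_gen[OF finite_isotropic finite_prim_reps])
  then have lines: "int (\<Sum>v\<in>V. card {y \<in> Y. on_line p v y}) = (p - 1) * int (card Y)"
    using p1 by simp
  have pairs: "p\<^sup>2 * int (card {v \<in> V. \<not> p dvd x \<bullet> v}) = p ^ n * (p - 1)" if "x \<in> X" for x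
    unfolding V_def
  proof (rule card_isotropic_not_orthogonal[OF p])
    show "x \<in> carrier_vec n" "p dvd x \<bullet> x" "\<not> vec_cong p x (0\<^sub>v n)"
      using that k by (auto simp: X_def prim_reps_def reps_def)
  qed
  have "(\<Sum>v\<in>V. card {x \<in> X. \<not> p dvd x \<bullet> v}) = (\<Sum>x\<in>X. card {v \<in> V. \<not> p dvd x \<bullet> v})"
    unfolding V_def X_def by (rule sum_multicount_gen[OF finite_isotropic finite_prim_reps]) simp
  then have "p\<^sup>2 * int (\<Sum>v\<in>V. card {x \<in> X. \<not> p dvd x \<bullet> v})
      = (\<Sum>x\<in>X. p\<^sup>2 * int (card {v \<in> V. \<not> p dvd x \<bullet> v}))"
    by (simp add: sum_distrib_left)
  also have "\<dots> = (p - 1) * (p ^ n * int (card X))" by (simp add: pairs)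
  also have "p ^ n = p\<^sup>2 * p ^ (n - 2)" using n(1) by (metis le_add_diff_inverse power_add)
  finally have "(p - 1) * int (card Y) = (p - 1) * (p ^ (n - 2) * int (card X))"
    using lines p1 card_prim_reps_on_line[OF p n(2)] by (simp add: V_def X_def Y_def)
  then show ?thesis using p1 by (simp add: X_def Y_def)
qed

lemma prim_reps_eq_reps:
  assumes "\<not> p\<^sup>2 dvd k" shows "prim_reps n p k = reps n k"
proof -
  have "p\<^sup>2 dvd x \<bullet> x" if "vec_cong p x (0\<^sub>v n)" for x
    using that unfolding scalar_prod_def power2_eq_square
    by (intro dvd_sum mult_dvd_mono) (auto simp: vec_cong_zero_iff)
  then show ?thesis using assms by (auto simp: prim_reps_def reps_def)
qed

theorem card_reps_prime_power:
  fixes p k :: int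
  assumes p: "prime p" "p \<noteq> 2" and n: "2 \<le> n" "n \<le> 5" and k: "\<not> p dvd k"
  shows "int (card (reps n (p ^ (2 * j + 1) * k)))
      = int (card (reps n (p * k))) * (\<Sum>i\<le>j. (p ^ (n - 2)) ^ i)"
proof -
  have p0: "p \<noteq> 0" using p(1) by auto
  have power_Suc: "p ^ (2 * Suc j + 1) * k = p\<^sup>2 * (p ^ (2 * j + 1) * k)" for j
    by (simp add: power2_eq_square)
  have prim: "int (card (prim_reps n p (p ^ (2 * j + 1) * k)))
      = (p ^ (n - 2)) ^ j * int (card (reps n (p * k)))" for j
  proof (induction j)
    case 0
    have "\<not> p\<^sup>2 dvd p * k" using k p0 by (simp add: power2_eq_square)
    then show ?case by (simp add: prim_reps_eq_reps)
  next
    case (Suc j)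
    then show ?case
      unfolding power_Suc using card_prim_reps_square[OF p n, of "p ^ (2 * j + 1) * k"] by simp
  qed
  show ?thesis
  proof (induction j)
    case 0
    then show ?case by simp
  next
    case (Suc j)
    have "int (card (reps n (p ^ (2 * Suc j + 1) * k)))
        = int (card (prim_reps n p (p ^ (2 * Suc j + 1) * k)))
          + int (card (reps n (p ^ (2 * j + 1) * k)))"
      unfolding power_Suc by (simp add: card_reps_square[OF p0])
    then show ?case
      unfolding Suc.IH prim by (simp only: sum.atMost_Suc distrib_left mult.commute add.commute)
  qed
qed

section \<open>Overpartitions and prime powers\<close>

lemma graded_carrier_vec: "graded (carrier_vec n) (\<lambda>x. x \<bullet> x)"
  unfolding graded_def using finite_reps[unfolded reps_def] scalar_prod_self_int_nonneg by blast

lemma counting_fps_carrier_vec: "counting_fps (carrier_vec n) (\<lambda>x. x \<bullet> x) = theta ^ n"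
proof (induction n)
  case 0
  have "{x \<in> carrier_vec 0. x \<bullet> x = int k} = (if k = 0 then {vNil} else {})" for k
    by (auto simp: scalar_prod_def)
  then show ?case by (intro fps_ext) (simp add: counting_fps_def)
next
  case (Suc n)
  let ?h = "\<lambda>(a, x). vCons a x :: int vec"
  have "x \<in> ?h ` (UNIV \<times> carrier_vec n)" if "x \<in> carrier_vec (Suc n)" for x
    using that by (cases x) (auto intro: rev_image_eqI)
  then have "bij_betw ?h (UNIV \<times> carrier_vec n) (carrier_vec (Suc n))"
    by (auto simp: bij_betw_def inj_on_def)
  then have "counting_fps (UNIV \<times> carrier_vec n) (\<lambda>(a, x). a\<^sup>2 + x \<bullet> x)
      = counting_fps (carrier_vec (Suc n)) (\<lambda>x. x \<bullet> x)"
    by (rule counting_fps_bij_betw) (auto simp: power2_eq_square)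
  then show ?case
    using counting_fps_Times[OF graded_square graded_carrier_vec, of UNIV n] Suc.IH
    by (simp add: theta_eq_counting_fps)
qed

lemma overpartition_count_cong_card_reps:
  "[(-1) ^ n * int (overpartition_count (3 * n)) = int (card (reps 5 (int n)))] (mod 9)"
  using overpartition_count_cong_theta[of n]
  by (simp add: counting_fps_carrier_vec[symmetric] counting_fps_def reps_def)

lemma overpartition_count_prime_power_dvd:
  fixes p N d j :: nat
  assumes p: "prime p" "p \<noteq> 2" and N: "\<not> p dvd N"
    and d: "d dvd 9" "int d dvd (\<Sum>i\<le>j. (int p ^ 3) ^ i)"
  shows "d dvd overpartition_count (3 * p ^ (2 * j + 1) * N)"
proof -
  define m where "m = p ^ (2 * j + 1) * N"
  have "prime (int p)" "int p \<noteq> 2" "\<not> int p dvd int N" using p N by auto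
  then have "int (card (reps 5 (int p ^ (2 * j + 1) * int N)))
      = int (card (reps 5 (int p * int N))) * (\<Sum>i\<le>j. (int p ^ 3) ^ i)"
    using card_reps_prime_power[of "int p" 5 "int N" j] by simp
  then have "int d dvd int (card (reps 5 (int m)))"
    using d(2) by (simp only: m_def of_nat_mult of_nat_power dvd_mult)
  moreover have "int d dvd 9" using d(1) int_dvd_int_iff[of d 9] by simp
  then have "[(-1) ^ m * int (overpartition_count (3 * m))
      = int (card (reps 5 (int m)))] (mod int d)"
    by (rule cong_dvd_modulus[OF overpartition_count_cong_card_reps])
  ultimately have "int d dvd (-1) ^ m * int (overpartition_count (3 * m))"
    by (simp only: cong_dvd_iff)
  then have "d dvd overpartition_count (3 * m)" by (simp add: minus_one_power_iff split: if_splits)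
  then show ?thesis by (simp only: m_def mult.assoc)
qed

lemma dvd_geometric_sum_if_cong_1:
  fixes x m :: int
  assumes "[x = 1] (mod m)" "m dvd int (Suc j)" shows "m dvd (\<Sum>i\<le>j. x ^ i)"
proof -
  have "[(\<Sum>i\<le>j. x ^ i) = (\<Sum>i\<le>j. 1 ^ i)] (mod m)" by (intro cong_sum cong_pow assms(1))
  then show ?thesis using assms(2) by (simp add: cong_dvd_iff)
qed

lemma dvd_geometric_sum_if_cong_minus_1:
  fixes x m :: int
  assumes "[x = - 1] (mod m)" shows "m dvd (\<Sum>i\<le>2 * a + 1. x ^ i)"
proof -
  have "[(\<Sum>i\<le>2 * a + 1. x ^ i) = (\<Sum>i\<le>2 * a + 1. (- 1) ^ i)] (mod m)"
    by (intro cong_sum cong_pow assms)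
  also have "(\<Sum>i\<le>2 * a + 1. (- 1) ^ i) = (0 :: int)" by (induction a) simp_all
  finally show ?thesis by (simp add: cong_0_iff)
qed

lemma overpartition_count_dvd_if_mod_3_eq_1:
  fixes p N d j :: nat
  assumes p: "prime p" "p mod 3 = 1" and N: "\<not> p dvd N" and d: "d dvd 9" "d dvd Suc j"
  shows "d dvd overpartition_count (3 * p ^ (2 * j + 1) * N)"
proof (rule overpartition_count_prime_power_dvd[OF p(1) _ N d(1)])
  show "p \<noteq> 2" using p(2) by auto
  have "[int p = 1] (mod 3)" using p(2) by (simp add: cong_def) presburger
  then have "[int p ^ 3 = 1] (mod 9)" using nine_dvd_cube_diff[of "int p" 1]
    by (simp add: cong_iff_dvd_diff)
  moreover have "int d dvd 9" using d(1) int_dvd_int_iff[of d 9] by simp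
  ultimately have "[int p ^ 3 = 1] (mod int d)" by (rule cong_dvd_modulus)
  moreover have "int d dvd int (Suc j)" using d(2) by (simp only: int_dvd_int_iff)
  ultimately show "int d dvd (\<Sum>i\<le>j. (int p ^ 3) ^ i)" by (rule dvd_geometric_sum_if_cong_1)
qed

lemma overpartition_count_dvd_if_mod_3_eq_2:
  fixes p N j :: nat
  assumes p: "prime p" "p \<noteq> 2" "p mod 3 = 2" and N: "\<not> p dvd N"
  shows "9 dvd overpartition_count (3 * p ^ (2 * (2 * j + 1) + 1) * N)"
proof (rule overpartition_count_prime_power_dvd[OF p(1,2) N])
  have "[int p = - 1] (mod 3)" using p(3) unfolding cong_def by presburger
  then have "[int p ^ 3 = - 1] (mod 9)" using nine_dvd_cube_diff[of "int p" "- 1"]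
    by (simp add: cong_iff_dvd_diff)
  then show "int 9 dvd (\<Sum>i\<le>2 * j + 1. (int p ^ 3) ^ i)"
    using dvd_geometric_sum_if_cong_minus_1 by (simp only: of_nat_numeral)
qed simp

theorem theorem6:
  fixes p N \<alpha> :: nat
  assumes "prime p" and "p \<ge> 3" and "N > 0" and "coprime N p"
  shows "(p mod 3 = 1 \<longrightarrow>
            overpartition_count (3 * p ^ (6 * \<alpha> + 5) * N) mod 3 = 0 \<and>
            overpartition_count (3 * p ^ (18 * \<alpha> + 17) * N) mod 9 = 0)
       \<and> (p mod 3 = 2 \<longrightarrow>
            overpartition_count (3 * p ^ (4 * \<alpha> + 3) * N) mod 9 = 0)"
proof (intro conjI impI)
  have N: "\<not> p dvd N"
    using assms(1,4) by (metis coprime_absorb_right coprime_commute not_prime_unit)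
  show "overpartition_count (3 * p ^ (6 * \<alpha> + 5) * N) mod 3 = 0" if "p mod 3 = 1"
  proof -
    have "6 * \<alpha> + 5 = 2 * (3 * \<alpha> + 2) + 1" "3 dvd Suc (3 * \<alpha> + 2)" by presburger+
    then show ?thesis
      using overpartition_count_dvd_if_mod_3_eq_1[OF assms(1) that N, of 3 "3 * \<alpha> + 2"]
      by (simp only: mod_eq_0_iff_dvd) simp
  qed
  show "overpartition_count (3 * p ^ (18 * \<alpha> + 17) * N) mod 9 = 0" if "p mod 3 = 1"
  proof -
    have "18 * \<alpha> + 17 = 2 * (9 * \<alpha> + 8) + 1" "9 dvd Suc (9 * \<alpha> + 8)" by presburger+
    then show ?thesis
      using overpartition_count_dvd_if_mod_3_eq_1[OF assms(1) that N, of 9 "9 * \<alpha> + 8"]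
      by (simp only: mod_eq_0_iff_dvd) simp
  qed
  show "overpartition_count (3 * p ^ (4 * \<alpha> + 3) * N) mod 9 = 0" if "p mod 3 = 2"
  proof -
    have "4 * \<alpha> + 3 = 2 * (2 * \<alpha> + 1) + 1" by simp
    then show ?thesis
      using overpartition_count_dvd_if_mod_3_eq_2[OF assms(1) _ that N, of \<alpha>] assms(2)
      by (simp only: mod_eq_0_iff_dvd)
  qed
qed

end
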